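(* If $f\in\mathcal{M}$ is pretentious, then $\|f\|_{u^2((N_k))}>0$ for some sequence $(N_k)$ defining a Furstenberg system of $f$.
   Context: $\mathcal{M}$ is the class of multiplicative functions $f:\mathbb{N}\to\mathbb{C}$ ($f(mn)=f(m)f(n)$ for coprime $m,n$) with $|f|\le1$. $f\in\mathcal{M}$ is pretentious if there are a Dirichlet character $\chi$ and $t\in\mathbb{R}$ with $\sum_{p\text{ prime}}\frac1p\big(1-\mathrm{Re}(f(p)\overline{\chi(p)p^{it}})\big)<+\infty$. Let $\mathbb{U}$ be the closed unit disc, $S$ the left shift on $\mathbb{U}^{\mathbb{Z}}$, and view $f$ as an element of $\mathbb{U}^{\mathbb{Z}}$ (extended e.g. by $0$ to non-positive integers). An increasing sequence $(N_k)$ defines a Furstenberg system of $f$ if $\frac1{N_k}\sum_{n\le N_k}\delta_{S^nf}$ converges in the weak$^*$ topology as $k\to\infty$. For such $(N_k)$ the Gowers–Host–Kra semi-norms are defined by $$\|f\|^2_{u^1((N_k))}=\lim_{H\to\infty}\frac1H\sum_{h\le H}\Big(\lim_{k\to\infty}\frac1{N_k}\sum_{n\le N_k}f(n)\overline{f(n+h)}\Big),$$ and, for $s\ge1$, $$\|f\|^{2^{s+1}}_{u^{s+1}((N_k))}=\lim_{H\to\infty}\frac1H\sum_{h\le H}\big\|f(\cdot+h)\cdot\overline{f(\cdot)}\big\|^{2^s}_{u^s((N_k))}$$ (the $u^s((N_k))$ semi-norm of $f(\cdot+h)\overline{f(\cdot)}$ is given by the same formulas). *)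

theory Defs
  imports "HOL-Probability.Probability" "HOL-Computational_Algebra.Primes"
begin

section \<open>Pretentious multiplicative functions\<close>

text \<open>Arithmetic functions live on the positive integers; the value at \<open>0\<close> is irrelevant.\<close>

definition bounded_multiplicative :: "(nat \<Rightarrow> complex) set" where
  "bounded_multiplicative = {f.
     (\<forall>m>0. \<forall>n>0. coprime m n \<longrightarrow> f (m * n) = f m * f n) \<and> (\<forall>n>0. norm (f n) \<le> 1)}"

definition dirichlet_character :: "nat \<Rightarrow> (nat \<Rightarrow> complex) \<Rightarrow> bool" where
  "dirichlet_character q chi \<longleftrightarrow> q > 0 \<and>
     (\<forall>m n. chi (m * n) = chi m * chi n) \<and>
     (\<forall>n. chi (n + q) = chi n) \<and>
     (\<forall>n. chi n \<noteq> 0 \<longleftrightarrow> coprime n q)"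

text \<open>The terms of the series are nonnegative when \<open>f\<close> is bounded by \<open>1\<close>,
  so finiteness of the sum is summability.\<close>

definition pretentious :: "(nat \<Rightarrow> complex) \<Rightarrow> bool" where
  "pretentious f \<longleftrightarrow> (\<exists>q chi (t::real). dirichlet_character q chi \<and>
     (\<lambda>p. 1 / real p * (1 - Re (f p * cnj (chi p * of_nat p powr (\<i> * of_real t)))))
       summable_on {p. prime p})"

section \<open>Furstenberg systems\<close>

text \<open>The compact space of two-sided sequences in the closed unit disc, as a subset of
  \<^typ>\<open>int \<Rightarrow> complex\<close>, whose topology is the product topology.\<close>

definition disc_seqs :: "(int \<Rightarrow> complex) set" where
  "disc_seqs = {x. \<forall>n. x n \<in> cball 0 1}"

definition disc_seqs_borel :: "(int \<Rightarrow> complex) measure" where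
  "disc_seqs_borel = restrict_space borel disc_seqs"

definition seq_shift :: "(int \<Rightarrow> complex) \<Rightarrow> int \<Rightarrow> complex" where
  "seq_shift x = (\<lambda>n. x (n + 1))"

definition extend_zero :: "(nat \<Rightarrow> complex) \<Rightarrow> int \<Rightarrow> complex" where
  "extend_zero f = (\<lambda>n. if n > 0 then f (nat n) else 0)"

text \<open>The measure \<open>1/N \<Sum>\<^sub>n\<^sub>\<le>\<^sub>N \<delta>\<close>, with Dirac masses at the \<open>n\<close>-th shifts of \<open>f\<close>,
  as the image of the uniform probability measure on \<open>{1..N}\<close>.\<close>

definition empirical_measure :: "(nat \<Rightarrow> complex) \<Rightarrow> nat \<Rightarrow> (int \<Rightarrow> complex) measure" where
  "empirical_measure f N =
     distr (uniform_count_measure {1..N}) disc_seqs_borel (\<lambda>n. (seq_shift ^^ n) (extend_zero f))"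

text \<open>Weak-star convergence, where (Borel) measures on the compact set \<open>X\<close> are viewed as
  functionals on \<open>C(X)\<close>.\<close>

definition weak_star_converges ::
    "'a::topological_space set \<Rightarrow> (nat \<Rightarrow> 'a measure) \<Rightarrow> 'a measure \<Rightarrow> bool" where
  "weak_star_converges X \<nu> \<mu> \<longleftrightarrow>
     (\<forall>F :: 'a \<Rightarrow> complex. continuous_on X F \<longrightarrow>
        (\<lambda>k. integral\<^sup>L (\<nu> k) F) \<longlonglongrightarrow> integral\<^sup>L \<mu> F)"

definition defines_furstenberg_system :: "(nat \<Rightarrow> nat) \<Rightarrow> (nat \<Rightarrow> complex) \<Rightarrow> bool" where
  "defines_furstenberg_system N f \<longleftrightarrow> strict_mono N \<and> (\<forall>k. N k > 0) \<and>
     (\<exists>\<mu>. prob_space \<mu> \<and> sets \<mu> = sets disc_seqs_borel \<and>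
        weak_star_converges disc_seqs (\<lambda>k. empirical_measure f (N k)) \<mu>)"

section \<open>Gowers--Host--Kra semi-norms\<close>

text \<open>\<open>u_seminorm N s f\<close> is the semi-norm of order \<open>s \<ge> 1\<close>; order \<open>0\<close> is left unspecified.
  It is meaningful when all the limits involved exist, as is the case when \<open>N\<close> defines a
  Furstenberg system of \<open>f\<close>. The limit in the case of order \<open>1\<close> is then a nonnegative real;
  \<^const>\<open>Re\<close> is there only to change the type.\<close>

fun u_seminorm :: "(nat \<Rightarrow> nat) \<Rightarrow> nat \<Rightarrow> (nat \<Rightarrow> complex) \<Rightarrow> real" where
  "u_seminorm N (Suc 0) f = sqrt (Re (lim (\<lambda>H. 1 / of_nat H * (\<Sum>h=1..H.
     lim (\<lambda>k. 1 / of_nat (N k) * (\<Sum>n=1..N k. f n * cnj (f (n + h))))))))"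
| "u_seminorm N (Suc (Suc s)) f = root (2 ^ Suc (Suc s)) (lim (\<lambda>H. 1 / real H * (\<Sum>h=1..H.
     u_seminorm N (Suc s) (\<lambda>n. f (n + h) * cnj (f n)) ^ (2 ^ Suc s))))"

end

theory Submission
  imports Defs "HOL-Computational_Algebra.Polynomial" "HOL-Real_Asymp.Real_Asymp"
begin

text \<open>
  Let \<open>f\<close> pretend to be \<open>\<psi>(n) n\<^sup>i\<^sup>t\<close>. Put \<open>v(n) = cnj (\<psi>(n) n\<^sup>i\<^sup>t)\<close> for \<open>n\<close> coprime to a suitable
  multiple \<open>Q\<close> of the conductor and \<open>v(n) = 0\<close> otherwise. Since \<open>Q\<close> absorbs the small primes, the
  Euler product of \<open>g = f v\<close> gives \<open>\<bar>\<Sum> g(n) n\<^sup>-\<^sup>s\<bar> \<ge> \<zeta>(s) / (2 Q\<^sup>s)\<close> for real \<open>s > 1\<close>, whereas by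
  partial summation this series would be \<open>o(\<zeta>(s))\<close> as \<open>s \<rightarrow> 1\<close> if the means of \<open>g\<close> tended to \<open>0\<close>.
  Hence the means of \<open>f v\<close> stay away from \<open>0\<close> along a sequence, which by compactness may be taken to
  define a Furstenberg system. As \<open>v(n + Q) - v(n) \<rightarrow> 0\<close>, the van der Corput argument shows that the
  correlations \<open>\<gamma>(h) = lim E\<^sub>n f(n + h) cnj (f(n))\<close> do not vanish on average over the multiples of \<open>Q\<close>,
  and \<open>\<parallel>f\<parallel>\<^sub>u\<^sub>2\<^sup>4\<close> dominates the mean of \<open>\<bar>\<gamma>(h)\<bar>\<^sup>2\<close>. That all the limits in the definition of the
  semi-norm exist is the mean ergodic theorem for stationary positive semidefinite kernels.
\<close>

text \<open>The semi-norms are nested \<open>lim\<close>s, and \<open>lim\<close> of a divergent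
  sequence is an unspecified value. Lower bounds along subsequences of \<open>H\<close> would
  therefore say nothing about \<open>u_seminorm\<close>: each limit has to be shown to exist, which
  is why so much of the development is ergodic theory. Only correlations enter there, so the Koopman
  operator on the \<open>L^2\<close> space of the system is replaced by polynomials with the form
  given by a kernel, and convergence is obtained without completing that space.

  On the arithmetic side, pretentiousness controls real parts only. The argument of the partial
  Euler products may keep turning, so the means of \<open>g\<close> need not converge; hence the use
  of absolute values at real \<open>s\<close>, and a conclusion that merely excludes convergence to
  0. The small primes are removed because a single Euler factor can vanish in the limit: with
  trivial character and \<open>t = 0\<close>, if \<open>f(2^k) = -1\<close> for all
  \<open>k \<ge> 1\<close>, the factor at 2 is \<open>1 - 1/2 - 1/4 - ... = 0\<close> at
  \<open>s = 1\<close>.\<close>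

section \<open>Compactness: subsequences defining Furstenberg systems\<close>

lemma compact_cantor_space: "compact (UNIV :: (nat \<Rightarrow> bool) set)"
proof -
  have "compact_space (product_topology (\<lambda>i::nat. euclidean :: bool topology) UNIV)"
    unfolding compact_space_product_topology
    by (intro disjI2 ballI) (simp add: compact_space_def finite_imp_compact)
  then show ?thesis
    by (simp add: euclidean_product_topology compact_space_def)
qed

lemma summable_digit_series:
  fixes c :: "nat \<Rightarrow> real"
  assumes "summable c" "\<And>i. c i \<ge> 0"
  shows "summable (\<lambda>i. of_bool (a i) * c i)"
  by (rule summable_comparison_test'[OF assms(1), of 0]) (use assms(2) in auto)

text \<open>The partial sums converge uniformly. Two sequences \<open>c\<close> occur below:
  \<open>(1/3) ^ i\<close> embeds Cantor space in the line, and \<open>(1/2) ^ Suc i\<close> maps it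
  onto the unit interval.\<close>

lemma continuous_on_digit_series:
  fixes c :: "nat \<Rightarrow> real"
  assumes c: "summable c" "\<And>i. c i \<ge> 0"
  shows "continuous_on UNIV (\<lambda>a :: nat \<Rightarrow> bool. \<Sum>i. of_bool (a i) * c i)"
proof -
  have lim: "uniform_limit UNIV (\<lambda>n a. \<Sum>i<n. of_bool (a i) * c i)
      (\<lambda>a :: nat \<Rightarrow> bool. \<Sum>i. of_bool (a i) * c i) sequentially"
    by (rule Weierstrass_m_test[OF _ c(1)]) (use c(2) in auto)
  have *: "continuous_on UNIV (\<lambda>a :: nat \<Rightarrow> bool. of_bool (a i) :: real)" for i
  proof -
    have "continuous_on UNIV (of_bool :: bool \<Rightarrow> real)"
      by (simp add: continuous_on_open_vimage open_discrete)
    from continuous_on_compose2[OF this continuous_on_product_coordinates]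
    show ?thesis by simp
  qed
  show ?thesis
    by (rule uniform_limit_theorem[OF _ lim])
       (simp_all only: trivial_limit_sequentially not_False_eq_True, intro always_eventually allI
        continuous_on_sum continuous_on_mult * continuous_on_const)
qed

text \<open>At the first index \<open>n\<close> where the digits differ, the difference has modulus
  \<open>(1/3) ^ n\<close>, and the later digits contribute at most half of that. In base 2 they
  could cancel it exactly.\<close>

lemma inj_ternary_series: "inj (\<lambda>a :: nat \<Rightarrow> bool. \<Sum>i. of_bool (a i) * (1/3 :: real) ^ i)"
proof (rule injI, rule ccontr)
  fix a b :: "nat \<Rightarrow> bool"
  let ?s = "\<lambda>a :: nat \<Rightarrow> bool. \<Sum>i. of_bool (a i) * (1/3 :: real) ^ i"
  assume eq: "?s a = ?s b" and "a \<noteq> b"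
  define n where "n = (LEAST i. a i \<noteq> b i)"
  have "\<exists>i. a i \<noteq> b i" using \<open>a \<noteq> b\<close> by blast
  then have n: "a n \<noteq> b n" unfolding n_def by (rule LeastI_ex)
  have before: "a i = b i" if "i < n" for i
    using not_less_Least[of i "\<lambda>i. a i \<noteq> b i"] that by (simp add: n_def)
  define d where "d = (\<lambda>i. (of_bool (a i) - of_bool (b i)) * (1/3 :: real) ^ i)"
  have sm: "summable (\<lambda>i. of_bool (a i) * (1/3 :: real) ^ i)" for a
    by (rule summable_digit_series) auto
  have "summable d" unfolding d_def left_diff_distrib by (intro summable_diff sm)
  have "suminf d = 0"
    unfolding d_def left_diff_distrib using eq by (subst suminf_diff[OF sm sm, symmetric]) auto
  have "(\<Sum>i<Suc n. d i) = d n"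
    using before by (auto simp: d_def)
  then have tail: "(\<Sum>i. d (i + Suc n)) = - d n"
    using suminf_split_initial_segment[OF \<open>summable d\<close>, of "Suc n"] \<open>suminf d = 0\<close> by simp
  have g: "summable (\<lambda>i. (1/3 :: real) ^ (i + Suc n))" "(\<Sum>i. (1/3 :: real) ^ (i + Suc n)) = (1/3)^n / 2"
  proof -
    show "summable (\<lambda>i. (1/3 :: real) ^ (i + Suc n))"
      by (intro summable_ignore_initial_segment) simp
    have "(\<Sum>i. (1/3 :: real) ^ (i + Suc n)) = (\<Sum>i. (1/3) ^ Suc n * (1/3) ^ i)"
      by (simp add: power_add mult_ac)
    also have "\<dots> = (1/3)^n / 2"
      by (subst suminf_mult) (auto simp: suminf_geometric)
    finally show "(\<Sum>i. (1/3 :: real) ^ (i + Suc n)) = (1/3)^n / 2" .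
  qed
  have "norm (\<Sum>i. d (i + Suc n)) \<le> (\<Sum>i. (1/3 :: real) ^ (i + Suc n))"
    by (rule norm_suminf_le[OF _ g(1)]) (auto simp: d_def)
  moreover have "norm (d n) = (1/3) ^ n"
    using n by (auto simp: d_def)
  moreover have "(0 :: real) < (1/3) ^ n" by simp
  ultimately show False using tail g(2) by (simp only: norm_minus_cancel)
qed

text \<open>The digits are the parities of the integer parts of \<open>2 ^ Suc i * x\<close>, and
  the partial sums are the integer part of \<open>2 ^ n * x\<close> divided by \<open>2 ^ n\<close>.
  At \<open>x = 1\<close> this recipe gives only zeros, so the expansion with all digits 1 is
  taken.\<close>

lemma binary_expansion_exists:
  fixes x :: real
  assumes "0 \<le> x" "x \<le> 1"
  shows "\<exists>a :: nat \<Rightarrow> bool. (\<Sum>i. of_bool (a i) * (1/2) ^ Suc i) = x"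
proof (cases "x = 1")
  case True
  have "(\<Sum>i. of_bool True * (1/2 :: real) ^ Suc i) = 1"
    using power_half_series sums_unique by fastforce
  then show ?thesis using True by (intro exI[of _ "\<lambda>_. True"]) simp
next
  case False
  define a where "a = (\<lambda>i. odd \<lfloor>2 ^ Suc i * x\<rfloor>)"
  have "(\<Sum>i<n. of_bool (a i) * (1/2 :: real) ^ Suc i) = of_int \<lfloor>2 ^ n * x\<rfloor> / 2 ^ n" for n
  proof (induction n)
    case 0
    have "\<lfloor>x\<rfloor> = 0" using assms False by (simp add: floor_eq_iff)
    then show ?case by simp
  next
    case (Suc n)
    have "\<lfloor>2 ^ Suc n * x\<rfloor> = 2 * \<lfloor>2 ^ n * x\<rfloor> + of_bool (a n)"
    proof -
      have "\<lfloor>2 ^ Suc n * x\<rfloor> div 2 = \<lfloor>2 ^ n * x\<rfloor>"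
        using floor_divide_real_eq_div[of 2 "2 ^ Suc n * x"] by simp
      then show ?thesis unfolding a_def
        by (metis mult_div_mod_eq mod2_eq_if of_bool_def)
    qed
    then show ?case using Suc by (simp add: field_simps)
  qed
  moreover have "(\<lambda>n. of_int \<lfloor>2 ^ n * x\<rfloor> / 2 ^ n) \<longlonglongrightarrow> x"
  proof (rule tendsto_sandwich)
    show "\<forall>\<^sub>F n in sequentially. x - (1/2)^n \<le> of_int \<lfloor>2 ^ n * x\<rfloor> / 2 ^ n"
    proof (rule always_eventually, rule allI)
      fix n :: nat
      have "2 ^ n * x - 1 \<le> of_int \<lfloor>2 ^ n * x\<rfloor>" by linarith
      then have "(2 ^ n * x - 1) / 2 ^ n \<le> of_int \<lfloor>2 ^ n * x\<rfloor> / 2 ^ n"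
        by (rule divide_right_mono) simp
      then show "x - (1/2)^n \<le> of_int \<lfloor>2 ^ n * x\<rfloor> / 2 ^ n"
        by (simp add: diff_divide_distrib power_one_over)
    qed
    show "\<forall>\<^sub>F n in sequentially. of_int \<lfloor>2 ^ n * x\<rfloor> / 2 ^ n \<le> x"
      by (rule always_eventually) (simp add: field_simps)
    have "(\<lambda>n. x - (1/2)^n) \<longlonglongrightarrow> x - 0"
      by (intro tendsto_intros LIMSEQ_power_zero) auto
    then show "(\<lambda>n. x - (1/2)^n) \<longlonglongrightarrow> x" by simp
  qed auto
  ultimately have "(\<lambda>i. of_bool (a i) * (1/2) ^ Suc i) sums x"
    by (simp add: sums_def)
  then show ?thesis by (intro exI[of _ a]) (simp add: sums_iff)
qed

text \<open>Polar coordinates make the disc an image of the unit square, so a point of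
  \<open>disc_seqs\<close> amounts to countably many numbers in \<open>[0, 1]\<close> and, by binary
  expansion, to countably many bit sequences. \<open>ix\<close> interleaves them into one: its
  Boolean selects modulus or angle, \<open>j\<close> the coordinate and \<open>i\<close> the
  digit.\<close>

lemma disc_seqs_cantor_image:
  obtains \<phi> :: "(nat \<Rightarrow> bool) \<Rightarrow> int \<Rightarrow> complex"
  where "continuous_on UNIV \<phi>" "range \<phi> = disc_seqs"
proof
  define r where "r = (\<lambda>(a :: nat \<Rightarrow> bool). \<Sum>i. of_bool (a i) * (1/2 :: real) ^ Suc i)"
  define ix where "ix = (\<lambda>(b::bool) (j::int) (i::nat). to_nat (b, j, i))"
  define \<phi> where "\<phi> = (\<lambda>(a :: nat \<Rightarrow> bool) (j::int).
    of_real (r (\<lambda>i. a (ix True j i))) * cis (2 * pi * r (\<lambda>i. a (ix False j i))))"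
  have r: "continuous_on UNIV r"
    unfolding r_def by (rule continuous_on_digit_series) auto
  have sub: "continuous_on UNIV (\<lambda>a. r (\<lambda>i. a (ix b j i)))" for b j
    by (rule continuous_on_compose2[OF r])
       (auto intro!: continuous_on_coordinatewise_then_product continuous_on_product_coordinates)
  show "continuous_on UNIV \<phi>"
    unfolding \<phi>_def cis_conv_exp
    by (intro continuous_on_coordinatewise_then_product continuous_intros sub)
  have r01: "0 \<le> r a" "r a \<le> 1" for a
  proof -
    have sm: "summable (\<lambda>i. of_bool (a i) * (1/2 :: real) ^ Suc i)"
      by (rule summable_digit_series) (auto simp: summable_Suc_iff)
    show "0 \<le> r a" unfolding r_def by (rule suminf_nonneg[OF sm]) auto
    have "r a \<le> (\<Sum>i. (1/2) ^ Suc i)"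
      unfolding r_def by (rule suminf_le[OF _ sm]) (auto simp: summable_Suc_iff)
    also have "\<dots> = 1" using power_half_series sums_unique by fastforce
    finally show "r a \<le> 1" .
  qed
  show "range \<phi> = disc_seqs"
  proof (intro subset_antisym subsetI)
    fix z assume "z \<in> range \<phi>"
    then show "z \<in> disc_seqs" using r01 by (auto simp: disc_seqs_def \<phi>_def norm_mult)
  next
    fix z assume z: "z \<in> disc_seqs"
    have "\<exists>a. r a = norm (z j)" for j
      using binary_expansion_exists[of "norm (z j)"] z by (auto simp: r_def disc_seqs_def)
    then obtain \<rho> where \<rho>: "\<And>j. r (\<rho> j) = norm (z j)" by metis
    have "\<exists>a. r a = Arg2pi (z j) / (2 * pi)" for j
      using binary_expansion_exists[of "Arg2pi (z j) / (2 * pi)"] Arg2pi[of "z j"]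
      by (auto simp: r_def)
    then obtain \<theta> where \<theta>: "\<And>j. r (\<theta> j) = Arg2pi (z j) / (2 * pi)" by metis
    define a where "a = (\<lambda>n. case from_nat n of (b, j, i) \<Rightarrow> (if b then \<rho> j i else \<theta> j i))"
    have "\<phi> a = z"
    proof
      fix j
      have "\<phi> a j = of_real (norm (z j)) * cis (Arg2pi (z j))"
        by (simp add: \<phi>_def a_def ix_def \<rho> \<theta>)
      then show "\<phi> a j = z j"
        using Arg2pi_eq[of "z j"] by (simp add: cis_conv_exp)
    qed
    then show "z \<in> range \<phi>" by blast
  qed
qed

section \<open>Empirical measures and their weak limits\<close>

lemma integral_uniform_count_measure_scaleR:
  fixes F :: "'a \<Rightarrow> 'b::{banach, second_countable_topology}"
  assumes "finite A"
  shows "integral\<^sup>L (uniform_count_measure A) F = (1 / card A) *\<^sub>R sum F A"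
  using assms
  by (simp add: uniform_count_measure_def lebesgue_integral_point_measure_finite scaleR_sum_right)

lemma integral_distr_uniform_count_measure:
  fixes F :: "'b \<Rightarrow> 'c::{banach, second_countable_topology}"
  assumes "finite A" "\<And>a. a \<in> A \<Longrightarrow> g a \<in> space M" "F \<in> borel_measurable M"
  shows "integral\<^sup>L (distr (uniform_count_measure A) M g) F = (1 / card A) *\<^sub>R (\<Sum>a\<in>A. F (g a))"
proof -
  have "g \<in> measurable (uniform_count_measure A) M"
    using assms(2)
    by (subst measurable_cong_sets[OF sets_uniform_count_measure_count_space refl]) auto
  from integral_distr[OF this assms(3)] show ?thesis
    by (simp add: integral_uniform_count_measure_scaleR assms(1))
qed

text \<open>The test function \<open>min 1 (infdist x K)\<close> is bounded, continuous and zero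
  exactly on the closed set \<open>K\<close>; its integrals against the \<open>\<nu> k\<close>
  vanish, hence so does the one against \<open>M\<close>.\<close>

lemma AE_in_closed_weak_limit:
  fixes \<nu> :: "nat \<Rightarrow> real measure"
  assumes \<nu>: "\<And>k. real_distribution (\<nu> k)" and M: "real_distribution M"
    and conv: "weak_conv_m \<nu> M" and K: "closed K" "K \<noteq> {}"
    and supp: "\<And>k. AE x in \<nu> k. x \<in> K"
  shows "AE x in M. x \<in> K"
proof -
  interpret M: real_distribution M by (rule M)
  define G :: "real \<Rightarrow> real" where "G = (\<lambda>x. min 1 (infdist x K))"
  have G: "continuous_on UNIV G" unfolding G_def by (intro continuous_intros)
  have G01: "0 \<le> G x" "norm (G x) \<le> 1" for x by (auto simp: G_def infdist_nonneg)
  have "(\<lambda>k. integral\<^sup>L (\<nu> k) G) \<longlonglongrightarrow> integral\<^sup>L M G"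
    by (rule weak_conv_imp_integral_bdd_continuous_conv[OF \<nu> M conv _ G01(2)])
       (use G in \<open>simp add: continuous_on_eq_continuous_at\<close>)
  moreover have "integral\<^sup>L (\<nu> k) G = 0" for k
  proof -
    have "AE x in \<nu> k. G x = 0" using supp[of k] by eventually_elim (simp add: G_def)
    then show ?thesis by (rule integral_eq_zero_AE)
  qed
  ultimately have "integral\<^sup>L M G = 0" by (simp add: LIMSEQ_const_iff)
  moreover have "integrable M G"
    by (rule M.integrable_const_bound[of _ 1])
       (use G01 borel_measurable_continuous_onI[OF G] in auto)
  ultimately have "AE x in M. G x = 0"
    using G01 by (subst (asm) integral_nonneg_eq_0_iff_AE) auto
  then show ?thesis
    by eventually_elim (use K in \<open>auto simp: G_def in_closed_iff_infdist_zero min_def split: if_splits\<close>)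
qed

lemma funpow_seq_shift: "(seq_shift ^^ n) z = (\<lambda>j. z (j + int n))"
  by (induction n) (auto simp: seq_shift_def algebra_simps)

lemma shift_extend_zero_in_disc_seqs:
  "(\<And>n. n > 0 \<Longrightarrow> norm (f n) \<le> 1) \<Longrightarrow> (seq_shift ^^ n) (extend_zero f) \<in> disc_seqs"
  by (auto simp: funpow_seq_shift disc_seqs_def extend_zero_def)

lemma space_disc_seqs_borel: "space disc_seqs_borel = disc_seqs"
  by (simp add: disc_seqs_borel_def space_restrict_space)

lemma borel_measurable_disc_seqs:
  "continuous_on disc_seqs F \<Longrightarrow> F \<in> borel_measurable disc_seqs_borel"
  unfolding disc_seqs_borel_def by (rule borel_measurable_continuous_on_restrict)

text \<open>Helly's selection theorem concerns measures on the line, so the empirical measures are first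
  lifted to a Cantor set in \<open>\<real>\<close> that maps continuously onto \<open>disc_seqs\<close>.\<close>

theorem furstenberg_subsequence:
  fixes f :: "nat \<Rightarrow> complex" and N0 :: "nat \<Rightarrow> nat"
  assumes f: "\<And>n. n > 0 \<Longrightarrow> norm (f n) \<le> 1"
    and N0: "strict_mono N0" "\<And>k. N0 k > 0"
  obtains r where "strict_mono r" "defines_furstenberg_system (N0 \<circ> r) f"
proof -
  define x where "x n = (seq_shift ^^ n) (extend_zero f)" for n
  have x: "x n \<in> disc_seqs" for n
    unfolding x_def by (rule shift_extend_zero_in_disc_seqs[OF f])
  obtain \<phi> :: "(nat \<Rightarrow> bool) \<Rightarrow> int \<Rightarrow> complex"
    where \<phi>: "continuous_on UNIV \<phi>" "range \<phi> = disc_seqs"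
    by (rule disc_seqs_cantor_image)
  define e where "e = (\<lambda>a :: nat \<Rightarrow> bool. \<Sum>i. of_bool (a i) * (1/3 :: real) ^ i)"
  define K where "K = range e"
  have e: "continuous_on UNIV e" unfolding e_def by (rule continuous_on_digit_series) auto
  obtain e' where hom: "homeomorphism UNIV K e e'"
    using homeomorphism_compact[OF compact_cantor_space e, of K] inj_ternary_series
    by (auto simp: K_def e_def)
  define \<psi> where "\<psi> = \<phi> \<circ> e'"
  have "compact K" unfolding K_def by (rule compact_continuous_image[OF e compact_cantor_space])
  then have K: "closed K" "K \<noteq> {}" "bounded K"
    by (auto simp: compact_imp_closed compact_imp_bounded K_def)
  have e': "continuous_on K e'" "e' ` K = UNIV"
    using hom by (auto simp: homeomorphism_def)
  have \<psi>: "continuous_on K \<psi>" "\<psi> ` K = disc_seqs"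
    unfolding \<psi>_def image_comp[symmetric]
    by (rule continuous_on_compose) (use \<phi> e' in auto)
  have "\<exists>y\<in>K. \<psi> y = x n" for n using x[of n] \<psi>(2) by (metis imageE)
  then obtain y where y: "\<And>n. y n \<in> K" "\<And>n. \<psi> (y n) = x n" by metis
  define \<nu> where "\<nu> k = distr (uniform_count_measure {1..N0 k}) borel y" for k :: nat
  have meas: "g \<in> measurable (uniform_count_measure {1..N0 k}) borel" for g :: "nat \<Rightarrow> real" and k
    by (subst measurable_cong_sets[OF sets_uniform_count_measure_count_space refl]) auto
  have prob: "prob_space (uniform_count_measure {1..N0 k})" for k
    by (rule prob_space_uniform_count_measure) (use N0(2)[of k] in auto)
  have \<nu>: "real_distribution (\<nu> k)" for k
    unfolding \<nu>_def by (rule prob_space.real_distribution_distr[OF prob meas])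
  have supp: "AE t in \<nu> k. t \<in> K" for k
    unfolding \<nu>_def using K(1) y(1) by (subst AE_distr_iff[OF meas]) auto
  obtain B where B: "B > 0" "\<And>t. t \<in> K \<Longrightarrow> \<bar>t\<bar> \<le> B"
    using K(3) bounded_pos by (metis real_norm_def)
  have "tight \<nu>" unfolding tight_def
  proof (intro conjI allI impI \<nu>)
    fix \<epsilon> :: real assume "\<epsilon> > 0"
    \<comment> \<open>Tightness is stated with half-open intervals, so the left end lies beyond
      \<open>- B\<close> in order to include that point.\<close>
    have "measure (\<nu> k) {- B - 1<..B} > 1 - \<epsilon>" for k
    proof -
      interpret real_distribution "\<nu> k" by (rule \<nu>)
      have "AE t in \<nu> k. t \<in> {- B - 1<..B}"
        using supp[of k] by eventually_elim (use B(2) in force)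
      then have "prob {- B - 1<..B} = 1" by (subst prob_eq_1) auto
      then show ?thesis using \<open>\<epsilon> > 0\<close> by simp
    qed
    then show "\<exists>a b. a < b \<and> (\<forall>n. 1 - \<epsilon> < measure (\<nu> n) {a<..b})"
      using B(1) by (intro exI[of _ "- B - 1"] exI[of _ B]) auto
  qed
  from tight_imp_convergent_subsubsequence[OF this strict_mono_id] obtain r M
    where r: "strict_mono r" "real_distribution M" "weak_conv_m (\<nu> \<circ> r) M"
    by (auto simp: comp_def id_def)
  interpret M: real_distribution M by (rule r(2))
  have AE_K: "AE t in M. t \<in> K"
    by (rule AE_in_closed_weak_limit[OF _ r(2,3) K(1,2)]) (simp_all only: o_def \<nu> supp)
  \<comment> \<open>\<open>\<psi>\<close> is meaningful on \<open>K\<close> only, which carries all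
    of \<open>M\<close>. The zero sequence as value elsewhere keeps \<open>\<psi>'\<close> inside
    \<open>disc_seqs\<close>.\<close>
  define \<psi>' where "\<psi>' t = (if t \<in> K then \<psi> t else (\<lambda>_. 0))" for t
  have \<psi>': "\<psi>' \<in> measurable M disc_seqs_borel"
    unfolding disc_seqs_borel_def
  proof (rule measurable_restrict_space2)
    have "\<psi>' t \<in> disc_seqs" for t
    proof (cases "t \<in> K")
      case True then show ?thesis using \<psi>(2) unfolding \<psi>'_def by (metis imageI)
    next
      case False then show ?thesis by (simp add: \<psi>'_def disc_seqs_def)
    qed
    then show "\<psi>' \<in> space M \<rightarrow> disc_seqs" by blast
    have "\<psi>' \<in> borel_measurable borel" unfolding \<psi>'_def
      using K(1) \<psi>(1) by (intro borel_measurable_continuous_on_if) auto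
    then show "\<psi>' \<in> borel_measurable M" by simp
  qed
  define \<mu> where "\<mu> = distr M disc_seqs_borel \<psi>'"
  have "weak_star_converges disc_seqs (\<lambda>k. empirical_measure f ((N0 \<circ> r) k)) \<mu>"
    unfolding weak_star_converges_def
  proof (intro allI impI)
    fix F :: "(int \<Rightarrow> complex) \<Rightarrow> complex" assume F: "continuous_on disc_seqs F"
    note Fm = borel_measurable_disc_seqs[OF F]
    have F\<psi>: "continuous_on K (F \<circ> \<psi>)"
      using \<psi> F by (intro continuous_on_compose) auto
    from compact_imp_bounded[OF compact_continuous_image[OF F\<psi> \<open>compact K\<close>]]
    obtain C where C: "C > 0" "\<And>t. t \<in> K \<Longrightarrow> norm ((F \<circ> \<psi>) t) \<le> C"
      unfolding bounded_pos by auto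
    \<comment> \<open>Weak convergence on the line tests bounded continuous functions on all of
      \<open>\<real>\<close>, so \<open>F \<circ> \<psi>\<close> is extended from \<open>K\<close>,
      outside of which neither the \<open>\<nu> k\<close> nor \<open>M\<close> have mass.\<close>
    obtain G where G: "continuous_on UNIV G" "\<And>t. t \<in> K \<Longrightarrow> G t = (F \<circ> \<psi>) t" "\<And>t. norm (G t) \<le> C"
      by (rule Tietze[OF F\<psi>, of UNIV C]) (use C K(1) in auto)
    have Gm: "G \<in> borel_measurable borel" by (rule borel_measurable_continuous_onI[OF G(1)])
    have "(\<lambda>k. integral\<^sup>L ((\<nu> \<circ> r) k) G) \<longlonglongrightarrow> integral\<^sup>L M G"
      by (rule weak_conv_imp_integral_bdd_continuous_conv[OF _ r(2,3) _ G(3)])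
         (use G(1) \<nu> in \<open>auto simp: continuous_on_eq_continuous_at\<close>)
    moreover have "integral\<^sup>L ((\<nu> \<circ> r) k) G = integral\<^sup>L (empirical_measure f ((N0 \<circ> r) k)) F" for k
      unfolding \<nu>_def empirical_measure_def o_def x_def[symmetric]
      using Gm Fm x G(2) y by (simp add: integral_distr_uniform_count_measure space_disc_seqs_borel)
    moreover have "integral\<^sup>L \<mu> F = integral\<^sup>L M G"
    proof -
      have "integral\<^sup>L \<mu> F = integral\<^sup>L M (\<lambda>t. F (\<psi>' t))"
        unfolding \<mu>_def by (rule integral_distr[OF \<psi>' Fm])
      also have "\<dots> = integral\<^sup>L M G"
      proof (rule integral_cong_AE)
        show "(\<lambda>t. F (\<psi>' t)) \<in> borel_measurable M" using measurable_compose[OF \<psi>' Fm] .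
        show "AE t in M. F (\<psi>' t) = G t"
          using AE_K by eventually_elim (simp add: \<psi>'_def G(2))
      qed (use Gm in simp)
      finally show ?thesis .
    qed
    ultimately show "(\<lambda>k. integral\<^sup>L (empirical_measure f ((N0 \<circ> r) k)) F) \<longlonglongrightarrow> integral\<^sup>L \<mu> F"
      by simp
  qed
  moreover have "prob_space \<mu>" unfolding \<mu>_def by (rule M.prob_space_distr[OF \<psi>'])
  moreover have "sets \<mu> = sets disc_seqs_borel" by (simp add: \<mu>_def)
  moreover have "strict_mono (N0 \<circ> r)" by (rule strict_mono_o[OF N0(1) r(1)])
  ultimately have "defines_furstenberg_system (N0 \<circ> r) f"
    unfolding defines_furstenberg_system_def using N0(2) by auto
  with r(1) show ?thesis by (rule that)
qed

section \<open>The mean ergodic theorem for stationary kernels\<close>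

text \<open>The model is \<open>K i j = <T^i x, T^j x>\<close> for an isometry \<open>T\<close> of a
  Hilbert space and a vector \<open>x\<close>. Below, \<open>x\<close> is the polynomial
  \<open>1\<close> and \<open>T\<close> is multiplication by \<open>X\<close>.\<close>

locale stationary_kernel =
  fixes K :: "nat \<Rightarrow> nat \<Rightarrow> complex"
  assumes stationary: "K (Suc i) (Suc j) = K i j"
    and hermitian: "K j i = cnj (K i j)"
    and pos_semidef: "0 \<le> Re (\<Sum>i<n. \<Sum>j<n. c i * cnj (c j) * K i j)"
begin

text \<open>A polynomial stands for the vector of its coefficients, so that shifting by one is
  multiplication by \<open>[:0, 1:]\<close> and averages of shifts commute.\<close>

definition ip :: "complex poly \<Rightarrow> complex poly \<Rightarrow> complex" where
  "ip u v = (\<Sum>i\<le>degree u. \<Sum>j\<le>degree v. coeff u i * cnj (coeff v j) * K i j)"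

definition nrm :: "complex poly \<Rightarrow> real" where
  "nrm u = sqrt (Re (ip u u))"

text \<open>Degrees change under addition and under shifts; sesquilinearity, isometry of the shift
  and positivity are all read off sums over a common range.\<close>

lemma ip_eq:
  assumes "degree u < n" "degree v < n"
  shows "ip u v = (\<Sum>i<n. \<Sum>j<n. coeff u i * cnj (coeff v j) * K i j)"
proof -
  have "ip u v = (\<Sum>i\<le>degree u. \<Sum>j<n. coeff u i * cnj (coeff v j) * K i j)"
    unfolding ip_def using assms by (intro sum.cong sum.mono_neutral_left) (auto simp: coeff_eq_0)
  also have "\<dots> = (\<Sum>i<n. \<Sum>j<n. coeff u i * cnj (coeff v j) * K i j)"
    using assms by (intro sum.mono_neutral_left) (auto simp: coeff_eq_0)
  finally show ?thesis .
qed

lemma ip_add_left: "ip (u + v) w = ip u w + ip v w"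
proof -
  define n where "n = Suc (max (degree w) (max (degree u) (degree v)))"
  have "degree (u + v) < n" "degree u < n" "degree v < n" "degree w < n"
    using degree_add_le_max[of u v] by (auto simp: n_def)
  then show ?thesis by (simp add: ip_eq[of _ n] algebra_simps sum.distrib)
qed

lemma ip_smult_left: "ip (smult c u) w = c * ip u w"
proof -
  define n where "n = Suc (max (degree w) (degree u))"
  have "degree (smult c u) < n" "degree u < n" "degree w < n"
    using degree_smult_le[of c u] by (auto simp: n_def)
  then show ?thesis by (simp add: ip_eq[of _ n] algebra_simps sum_distrib_left)
qed

lemma cnj_ip: "cnj (ip u v) = ip v u"
  unfolding ip_def by (subst sum.swap) (simp add: hermitian[symmetric] mult_ac)

lemma ip_add_right: "ip w (u + v) = ip w u + ip w v"
  by (metis cnj_ip ip_add_left complex_cnj_add)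

lemma ip_smult_right: "ip w (smult c u) = cnj c * ip w u"
  by (metis cnj_ip ip_smult_left complex_cnj_mult)

lemma ip_diff_left: "ip (u - v) w = ip u w - ip v w"
  using ip_add_left[of "u - v" v w] by simp

lemma ip_diff_right: "ip w (u - v) = ip w u - ip w v"
  using ip_add_right[of w "u - v" v] by simp

lemma ip_minus_right [simp]: "ip w (- v) = - ip w v"
  using ip_smult_right[of w "-1" v] by simp

lemma ip_0_left [simp]: "ip 0 w = 0" and ip_0_right [simp]: "ip w 0 = 0"
  by (simp_all add: ip_def)

lemma ip_sum_left: "ip (\<Sum>x\<in>A. u x) w = (\<Sum>x\<in>A. ip (u x) w)"
  by (induction A rule: infinite_finite_induct) (auto simp: ip_add_left)

lemma ip_sum_right: "ip w (\<Sum>x\<in>A. u x) = (\<Sum>x\<in>A. ip w (u x))"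
  by (induction A rule: infinite_finite_induct) (auto simp: ip_add_right)

lemma ip_pCons_0: "ip (pCons 0 u) (pCons 0 v) = ip u v"
proof -
  define n where "n = Suc (max (degree u) (degree v))"
  have "ip (pCons 0 u) (pCons 0 v)
      = (\<Sum>i<Suc n. \<Sum>j<Suc n. coeff (pCons 0 u) i * cnj (coeff (pCons 0 v) j) * K i j)"
    by (rule ip_eq) (use degree_pCons_le[of 0 u] degree_pCons_le[of 0 v] in \<open>auto simp: n_def\<close>)
  also have "\<dots> = (\<Sum>i<n. \<Sum>j<n. coeff u i * cnj (coeff v j) * K i j)"
    unfolding sum.lessThan_Suc_shift by (simp add: stationary)
  also have "\<dots> = ip u v"
    by (rule ip_eq[symmetric]) (auto simp: n_def)
  finally show ?thesis .
qed

lemma ip_self: "ip u u = of_real ((nrm u)\<^sup>2)"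
proof (rule complex_eqI)
  have "0 \<le> Re (ip u u)"
    unfolding ip_eq[OF lessI lessI] by (rule pos_semidef)
  then show "Re (ip u u) = Re (of_real ((nrm u)\<^sup>2))" by (simp add: nrm_def)
  show "Im (ip u u) = Im (of_real ((nrm u)\<^sup>2))"
    using cnj_ip[of u u] by (simp add: complex_eq_iff)
qed

lemma nrm_nonneg: "0 \<le> nrm u"
proof -
  have "0 \<le> Re (ip u u)" by (simp add: ip_self)
  then show ?thesis by (simp add: nrm_def)
qed

lemma nrm_squared_add: "(nrm (u + v))\<^sup>2 = (nrm u)\<^sup>2 + 2 * Re (ip u v) + (nrm v)\<^sup>2"
proof -
  have "of_real ((nrm (u + v))\<^sup>2) = ip u u + (ip u v + cnj (ip u v)) + ip v v"
    by (simp only: ip_self[symmetric] ip_add_left ip_add_right cnj_ip add_ac)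
  then have "Re (of_real ((nrm (u + v))\<^sup>2)) = Re (ip u u + (ip u v + cnj (ip u v)) + ip v v)"
    by simp
  then show ?thesis by (simp add: ip_self)
qed

lemma nrm_smult: "nrm (smult c u) = norm c * nrm u"
proof -
  have "ip (smult c u) (smult c u) = of_real ((norm c)\<^sup>2) * ip u u"
    by (simp only: ip_smult_left ip_smult_right complex_norm_square mult_ac)
  then have "Re (ip (smult c u) (smult c u)) = (norm c)\<^sup>2 * Re (ip u u)"
    by (simp only: Re_complex_of_real times_complex.sel Im_complex_of_real)
  then show ?thesis by (simp add: nrm_def real_sqrt_mult)
qed

text \<open>The form may be degenerate, so vectors of norm 0 need a case of their own: there
  \<open>quad\<close> is affine in \<open>t\<close> and would become negative for large
  \<open>t\<close> unless \<open>z = 0\<close>. Otherwise \<open>t = 1 / (nrm v)^2\<close> minimizes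
  the quadratic.\<close>

lemma cauchy_schwarz: "norm (ip u v) \<le> nrm u * nrm v"
proof -
  define z where "z = norm (ip u v)"
  have quad: "0 \<le> (nrm u)\<^sup>2 - 2 * t * z\<^sup>2 + t\<^sup>2 * z\<^sup>2 * (nrm v)\<^sup>2" for t :: real
  proof -
    define c where "c = - of_real t * ip u v"
    have "ip u (smult c v) = - of_real t * of_real (z\<^sup>2)"
      unfolding z_def complex_norm_square by (simp add: ip_smult_right c_def)
    then have "Re (ip u (smult c v)) = - t * z\<^sup>2"
      by (simp del: of_real_power)
    moreover have "(nrm (smult c v))\<^sup>2 = t\<^sup>2 * z\<^sup>2 * (nrm v)\<^sup>2"
      by (simp only: nrm_smult power_mult_distrib) (simp add: c_def z_def norm_mult power_mult_distrib)
    ultimately show ?thesis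
      using nrm_squared_add[of u "smult c v"] zero_le_power2[of "nrm (u + smult c v)"] by simp
  qed
  have "z\<^sup>2 \<le> (nrm u)\<^sup>2 * (nrm v)\<^sup>2"
  proof (cases "nrm v = 0")
    case True
    have "z\<^sup>2 = 0"
    proof (rule ccontr)
      assume "z\<^sup>2 \<noteq> 0"
      then have "z\<^sup>2 > 0" by simp
      then show False
        using quad[of "((nrm u)\<^sup>2 + 1) / (2 * z\<^sup>2)"] True by (simp add: field_simps)
    qed
    then show ?thesis by simp
  next
    case False
    then have "(nrm v)\<^sup>2 > 0" by simp
    have "(1 / (nrm v)\<^sup>2)\<^sup>2 * z\<^sup>2 * (nrm v)\<^sup>2 = z\<^sup>2 / (nrm v)\<^sup>2"
      using False by (simp add: power2_eq_square)
    then have "z\<^sup>2 / (nrm v)\<^sup>2 \<le> (nrm u)\<^sup>2"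
      using quad[of "1 / (nrm v)\<^sup>2"] by simp
    then show ?thesis
      by (rule pos_divide_le_eq[THEN iffD1, OF \<open>(nrm v)\<^sup>2 > 0\<close>])
  qed
  then have "z\<^sup>2 \<le> (nrm u * nrm v)\<^sup>2" by (simp only: power_mult_distrib)
  then have "z \<le> nrm u * nrm v"
    by (rule power2_le_imp_le) (simp add: nrm_nonneg)
  then show ?thesis by (simp add: z_def)
qed

lemma nrm_triangle: "nrm (u + v) \<le> nrm u + nrm v"
proof (rule power2_le_imp_le)
  have "Re (ip u v) \<le> nrm u * nrm v"
    using complex_Re_le_cmod[of "ip u v"] cauchy_schwarz[of u v] by linarith
  then show "(nrm (u + v))\<^sup>2 \<le> (nrm u + nrm v)\<^sup>2"
    unfolding nrm_squared_add power2_sum by simp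
qed (simp add: nrm_nonneg)

lemma nrm_minus [simp]: "nrm (- u) = nrm u"
  using nrm_smult[of "-1" u] by simp

lemma nrm_0 [simp]: "nrm 0 = 0" by (simp add: nrm_def)

lemma nrm_sum: "nrm (\<Sum>x\<in>A. u x) \<le> (\<Sum>x\<in>A. nrm (u x))"
  by (induction A rule: infinite_finite_induct) (auto intro: order_trans[OF nrm_triangle])

lemma nrm_diff: "nrm (u - v) \<le> nrm u + nrm v"
  using nrm_triangle[of u "- v"] by simp

lemma parallelogram: "(nrm (u - v))\<^sup>2 = 2 * (nrm u)\<^sup>2 + 2 * (nrm v)\<^sup>2 - (nrm (u + v))\<^sup>2"
  using nrm_squared_add[of u v] nrm_squared_add[of u "- v"] by simp

abbreviation X :: "complex poly" where "X \<equiv> [:0, 1:]"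

lemma ip_X_power: "ip (X ^ i) (X ^ j) = K i j"
proof -
  have c: "coeff (X ^ k) l = of_bool (k = l)" for k l
    by (simp add: monom_altdef[of 1, simplified, symmetric])
  have "ip (X ^ i) (X ^ j) = (\<Sum>k<Suc (max i j). \<Sum>l<Suc (max i j). coeff (X ^ i) k * cnj (coeff (X ^ j) l) * K k l)"
    by (rule ip_eq) (auto simp: degree_power_eq)
  also have "\<dots> = (\<Sum>k<Suc (max i j). \<Sum>l<Suc (max i j). if i = k then if j = l then K k l else 0 else 0)"
    by (intro sum.cong refl) (auto simp: c)
  also have "\<dots> = (\<Sum>k<Suc (max i j). if i = k then \<Sum>l<Suc (max i j). if j = l then K k l else 0 else 0)"
    by (intro sum.cong refl) auto
  also have "\<dots> = K i j" by (auto simp: sum.delta' simp del: sum.lessThan_Suc)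
  finally show ?thesis .
qed

lemma ip_shift: "ip (X ^ i * u) (X ^ i * v) = ip u v"
  by (induction i) (simp_all add: mult.assoc ip_pCons_0)

lemma nrm_shift: "nrm (X ^ i * u) = nrm u"
  by (simp add: nrm_def ip_shift)

section \<open>Averages of shifts and their asymptotic invariance\<close>

definition avg_shift :: "nat \<Rightarrow> complex poly" where
  "avg_shift L = smult (1 / of_nat L) (\<Sum>i<L. X ^ i)"

lemma nrm_avg_shift_mult:
  assumes "L > 0"
  shows "nrm (avg_shift L * u) \<le> nrm u"
proof -
  have "nrm (avg_shift L * u) = nrm (\<Sum>i<L. X ^ i * u) / L"
    by (simp add: avg_shift_def nrm_smult norm_divide sum_distrib_right)
  also have "\<dots> \<le> (\<Sum>i<L. nrm (X ^ i * u)) / L"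
    by (intro divide_right_mono nrm_sum) simp
  also have "\<dots> = nrm u" using assms by (simp add: nrm_shift)
  finally show ?thesis .
qed

text \<open>Two geometric sums exchange their roles: \<open>(1 + ... + X^(L-1)) (1 - X^i) = (1 + ...
  + X^(i-1)) (1 - X^L)\<close>. This leaves \<open>i\<close> terms of norm at most
  \<open>2 * nrm 1\<close>, however large \<open>L\<close> is.\<close>

lemma nrm_avg_shift_diff: "nrm (avg_shift L * (1 - X ^ i)) \<le> 2 * real i * nrm 1 / L"
proof -
  have "(\<Sum>j<L. X ^ j) * (1 - X ^ i) = (\<Sum>j<i. X ^ j * (1 - X ^ L))"
    unfolding one_diff_power_eq[of X i] sum_distrib_right[symmetric] one_diff_power_eq[of X L]
    by (simp add: mult_ac)
  then have "nrm (avg_shift L * (1 - X ^ i)) = nrm (\<Sum>j<i. X ^ j * (1 - X ^ L)) / L"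
    by (simp add: avg_shift_def nrm_smult norm_divide)
  also have "\<dots> \<le> (\<Sum>j<i. nrm (X ^ j * (1 - X ^ L))) / L"
    by (intro divide_right_mono nrm_sum) simp
  also have "\<dots> \<le> (\<Sum>j<i. 2 * nrm 1) / L"
    using nrm_diff[of 1 "X ^ L"] nrm_shift[of L 1]
    by (intro divide_right_mono sum_mono) (simp_all add: nrm_shift)
  finally show ?thesis by (simp add: mult_ac)
qed

lemma one_diff_avg_shift:
  "M > 0 \<Longrightarrow> 1 - avg_shift M = smult (1 / of_nat M) (\<Sum>i<M. 1 - X ^ i)"
  by (simp add: avg_shift_def sum_subtractf smult_diff_right of_nat_poly)

text \<open>Long averages absorb short ones: for fixed \<open>M\<close> the bound vanishes as
  \<open>L \<rightarrow> \<infinity>\<close>.\<close>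

lemma nrm_avg_shift_one_diff:
  assumes "M > 0"
  shows "nrm (avg_shift L * (1 - avg_shift M)) \<le> 2 * real M * nrm 1 / L"
proof -
  have "nrm (avg_shift L * (1 - avg_shift M)) = nrm (\<Sum>i<M. avg_shift L * (1 - X ^ i)) / M"
    unfolding one_diff_avg_shift[OF assms]
    by (simp add: nrm_smult norm_divide sum_distrib_left)
  also have "\<dots> \<le> (\<Sum>i<M. nrm (avg_shift L * (1 - X ^ i))) / M"
    by (intro divide_right_mono nrm_sum) simp
  also have "\<dots> \<le> (\<Sum>i<M. 2 * real M * nrm 1 / L) / M"
    by (intro divide_right_mono sum_mono order_trans[OF nrm_avg_shift_diff])
       (auto intro!: divide_right_mono mult_right_mono simp: nrm_nonneg)
  finally show ?thesis using assms by simp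
qed

text \<open>The shift need not be invertible, so it cannot be carried across the form as its
  inverse. Instead \<open>ip 1 u = ip (X ^ i) (X ^ i * u)\<close> turns a difference in the left
  argument into one in the right argument, which the average nearly annihilates.\<close>

lemma norm_ip_one_diff_avg_shift:
  assumes "M > 0"
  shows "norm (ip (1 - avg_shift M) (avg_shift J)) \<le> 2 * real M * (nrm 1)\<^sup>2 / J"
proof -
  have 1: "norm (ip (1 - X ^ i) (avg_shift J)) \<le> 2 * real M * (nrm 1)\<^sup>2 / J" if "i < M" for i
  proof -
    have "ip (1 - X ^ i) (avg_shift J) = ip (X ^ i) (X ^ i * avg_shift J) - ip (X ^ i) (avg_shift J)"
      using ip_shift[of i 1 "avg_shift J"] by (simp add: ip_diff_left)
    also have "\<dots> = - ip (X ^ i) (avg_shift J * (1 - X ^ i))"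
      by (simp add: ip_diff_right algebra_simps)
    also have "norm \<dots> \<le> nrm (X ^ i) * nrm (avg_shift J * (1 - X ^ i))"
      by (simp add: cauchy_schwarz)
    also have "\<dots> \<le> nrm 1 * (2 * real i * nrm 1 / J)"
      using nrm_shift[of i 1] mult_left_mono[OF nrm_avg_shift_diff[of J i] nrm_nonneg[of 1]] by simp
    also have "\<dots> \<le> 2 * real M * (nrm 1)\<^sup>2 / J"
      using that nrm_nonneg[of 1]
      by (simp add: power2_eq_square divide_right_mono mult_left_mono mult_right_mono mult.assoc mult.left_commute)
    finally show ?thesis .
  qed
  have "norm (ip (1 - avg_shift M) (avg_shift J)) = norm (\<Sum>i<M. ip (1 - X ^ i) (avg_shift J)) / M"
    unfolding one_diff_avg_shift[OF assms]
    by (simp add: ip_smult_left ip_sum_left norm_divide)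
  also have "\<dots> \<le> (\<Sum>i<M. 2 * real M * (nrm 1)\<^sup>2 / J) / M"
    by (intro divide_right_mono order_trans[OF norm_sum] sum_mono 1) auto
  finally show ?thesis using assms by simp
qed

text \<open>The norm of the projection of \<open>1\<close> to the shift-invariant vectors of the
  completed space, written as an infimum so that the completion never appears.\<close>

definition inf_nrm :: real where
  "inf_nrm = (INF L\<in>{0<..}. nrm (avg_shift L))"

lemma inf_nrm_le: "L > 0 \<Longrightarrow> inf_nrm \<le> nrm (avg_shift L)"
  unfolding inf_nrm_def by (rule cINF_lower) (auto intro!: bdd_belowI2[of _ 0] nrm_nonneg)

lemma inf_nrm_nonneg: "0 \<le> inf_nrm"
  unfolding inf_nrm_def by (rule cINF_greatest) (auto simp: nrm_nonneg)

text \<open>Up to a vanishing error \<open>avg_shift L\<close> equals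
  \<open>avg_shift L * avg_shift M\<close>, whose norm is at most \<open>nrm (avg_shift M)\<close>;
  choose \<open>M\<close> nearly minimal.\<close>

lemma nrm_avg_shift_tendsto: "(\<lambda>L. nrm (avg_shift L)) \<longlonglongrightarrow> inf_nrm"
proof (rule LIMSEQ_I)
  fix e :: real assume e: "e > 0"
  have "\<exists>M\<in>{0<..}. nrm (avg_shift M) < inf_nrm + e / 2"
    using e cInf_lessD[of "(\<lambda>L. nrm (avg_shift L)) ` {0<..}" "inf_nrm + e / 2"]
    by (auto simp: inf_nrm_def)
  then obtain M where M: "M > 0" "nrm (avg_shift M) < inf_nrm + e / 2" by auto
  have "(\<lambda>L. 2 * real M * nrm 1 / real L) \<longlonglongrightarrow> 0"
    by (intro tendsto_divide_0[OF tendsto_const] filterlim_real_sequentially filterlim_at_top_imp_at_infinity)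
  then have "\<forall>\<^sub>F L in sequentially. 2 * real M * nrm 1 / real L < e / 2"
    using e by (intro order_tendstoD) auto
  with eventually_gt_at_top[of 0]
  have "\<forall>\<^sub>F L in sequentially. norm (nrm (avg_shift L) - inf_nrm) < e"
  proof eventually_elim
    case (elim L)
    have "nrm (avg_shift L) \<le> nrm (avg_shift L * avg_shift M) + nrm (avg_shift L * (1 - avg_shift M))"
      using nrm_triangle[of "avg_shift L * avg_shift M" "avg_shift L * (1 - avg_shift M)"]
      by (simp add: algebra_simps)
    also have "nrm (avg_shift L * avg_shift M) \<le> nrm (avg_shift M)"
      using elim by (intro nrm_avg_shift_mult)
    also have "nrm (avg_shift L * (1 - avg_shift M)) \<le> 2 * real M * nrm 1 / L"
      by (rule nrm_avg_shift_one_diff[OF M(1)])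
    finally show ?case using M(2) elim inf_nrm_le[of L] by simp
  qed
  then show "\<exists>no. \<forall>n\<ge>no. norm (nrm (avg_shift n) - inf_nrm) < e"
    by (simp add: eventually_sequentially)
qed

text \<open>Riesz's argument: the midpoint of two averages is again a convex combination of shifts,
  so its product with \<open>avg_shift L\<close> is close to \<open>avg_shift L\<close> for large
  \<open>L\<close>. Together with the parallelogram law this gives the Cauchy estimate
  \<open>nrm_avg_shift_cauchy\<close>.\<close>

lemma inf_nrm_le_midpoint:
  assumes "J > 0" "M > 0"
  shows "2 * inf_nrm \<le> nrm (avg_shift J + avg_shift M)"
proof -
  have "\<forall>\<^sub>F L in sequentially. 2 * nrm (avg_shift L)
      \<le> nrm (avg_shift J + avg_shift M) + (2 * real J * nrm 1 / L + 2 * real M * nrm 1 / L)"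
    using eventually_gt_at_top[of 0]
  proof eventually_elim
    case (elim L)
    let ?A = "avg_shift L"
    have "2 * nrm ?A = nrm (smult 2 ?A)" by (simp add: nrm_smult)
    also have "smult 2 ?A = ?A + ?A"
      by (metis smult_add_left one_add_one smult_1_left)
    also have "\<dots> = ?A * (avg_shift J + avg_shift M)
        + (?A * (1 - avg_shift J) + ?A * (1 - avg_shift M))"
      by (simp add: algebra_simps)
    also have "nrm \<dots> \<le> nrm (?A * (avg_shift J + avg_shift M))
        + (nrm (?A * (1 - avg_shift J)) + nrm (?A * (1 - avg_shift M)))"
      by (intro order_trans[OF nrm_triangle] add_mono order_refl nrm_triangle)
    also have "\<dots> \<le> nrm (avg_shift J + avg_shift M) + (2 * real J * nrm 1 / L + 2 * real M * nrm 1 / L)"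
      using elim assms by (intro add_mono nrm_avg_shift_mult nrm_avg_shift_one_diff)
    finally show ?case .
  qed
  moreover have "(\<lambda>L. nrm (avg_shift J + avg_shift M) + (2 * real J * nrm 1 / real L + 2 * real M * nrm 1 / real L))
      \<longlonglongrightarrow> nrm (avg_shift J + avg_shift M) + (0 + 0)"
    by (intro tendsto_add tendsto_const tendsto_divide_0[OF tendsto_const]
        filterlim_real_sequentially filterlim_at_top_imp_at_infinity)
  moreover have "(\<lambda>L. 2 * nrm (avg_shift L)) \<longlonglongrightarrow> 2 * inf_nrm"
    by (intro tendsto_intros nrm_avg_shift_tendsto)
  ultimately have "2 * inf_nrm \<le> nrm (avg_shift J + avg_shift M) + (0 + 0)"
    by (intro tendsto_le[OF sequentially_bot]) auto
  then show ?thesis by simp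
qed

lemma nrm_avg_shift_cauchy:
  assumes "J > 0" "M > 0"
  shows "(nrm (avg_shift J - avg_shift M))\<^sup>2
    \<le> 2 * ((nrm (avg_shift J))\<^sup>2 - inf_nrm\<^sup>2) + 2 * ((nrm (avg_shift M))\<^sup>2 - inf_nrm\<^sup>2)"
proof -
  have "(2 * inf_nrm)\<^sup>2 \<le> (nrm (avg_shift J + avg_shift M))\<^sup>2"
    using inf_nrm_nonneg by (intro power_mono inf_nrm_le_midpoint assms) auto
  then show ?thesis unfolding parallelogram by (simp add: power2_eq_square)
qed

text \<open>The Cauchy estimate stands in for the invariant projection. \<open>bound\<close>
  replaces \<open>X * avg_shift J\<close> by \<open>avg_shift J\<close>, then \<open>1\<close> by
  \<open>avg_shift M\<close>, then \<open>avg_shift J\<close> by \<open>avg_shift M\<close>, and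
  ends at \<open>ip (avg_shift M) (avg_shift M)\<close>. The errors vanish as
  \<open>J \<rightarrow> \<infinity>\<close> for fixed \<open>M\<close> and then
  \<open>M \<rightarrow> \<infinity>\<close>.\<close>

theorem mean_ergodic: "(\<lambda>H. 1 / of_nat H * (\<Sum>h=1..H. K 0 h)) \<longlonglongrightarrow> of_real (inf_nrm\<^sup>2)"
proof -
  define E where "E J = (nrm (avg_shift J))\<^sup>2 - inf_nrm\<^sup>2" for J
  have "(\<lambda>J. (nrm (avg_shift J))\<^sup>2 - inf_nrm\<^sup>2) \<longlonglongrightarrow> inf_nrm\<^sup>2 - inf_nrm\<^sup>2"
    by (intro tendsto_intros nrm_avg_shift_tendsto)
  then have E: "E \<longlonglongrightarrow> 0" by (simp add: E_def[abs_def])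
  have E0: "E J \<ge> 0" if "J > 0" for J
    using inf_nrm_le[OF that] inf_nrm_nonneg by (simp add: E_def power_mono)
  have ipX: "ip 1 (X ^ j) = K 0 j" for j
    using ip_X_power[of 0 j] by simp
  \<comment> \<open>The averages start at \<open>h = 1\<close>, whence the factor
    \<open>X\<close>.\<close>
  have avg: "1 / of_nat J * (\<Sum>h=1..J. K 0 h) = ip 1 (X * avg_shift J)" for J
  proof -
    have "ip 1 (X * avg_shift J) = 1 / of_nat J * (\<Sum>i<J. ip 1 (X ^ Suc i))"
      by (simp only: avg_shift_def mult_smult_right ip_smult_right sum_distrib_left ip_sum_right
          power_Suc) simp
    also have "(\<Sum>i<J. ip 1 (X ^ Suc i)) = (\<Sum>h=1..J. K 0 h)"
      unfolding ipX by (rule sum.reindex_bij_witness[of _ "\<lambda>h. h - 1" Suc]) auto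
    finally show ?thesis ..
  qed
  have bound: "norm (ip 1 (X * avg_shift J) - of_real (inf_nrm\<^sup>2))
      \<le> 2 * (nrm 1)\<^sup>2 / J + (2 * real M * (nrm 1)\<^sup>2 / J + (nrm 1 * sqrt (2 * E J + 2 * E M) + E M))"
    if "J > 0" "M > 0" for J M
  proof -
    have "ip 1 (X * avg_shift J) - of_real (inf_nrm\<^sup>2)
      = - ip 1 (avg_shift J * (1 - X ^ 1)) + (ip (1 - avg_shift M) (avg_shift J)
        + (ip (avg_shift M) (avg_shift J - avg_shift M) + of_real (E M)))"
    proof -
      have "avg_shift J * (1 - X ^ 1) = avg_shift J - X * avg_shift J" by (simp add: algebra_simps)
      then show ?thesis by (simp add: ip_diff_left ip_diff_right ip_self E_def)
    qed
    also have "norm \<dots> \<le> norm (ip 1 (avg_shift J * (1 - X ^ 1))) + (norm (ip (1 - avg_shift M) (avg_shift J))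
        + (norm (ip (avg_shift M) (avg_shift J - avg_shift M)) + norm (of_real (E M) :: complex)))"
      by (intro order_trans[OF norm_triangle_ineq] add_mono order_refl) simp_all
    also have "\<dots> \<le> 2 * (nrm 1)\<^sup>2 / J + (2 * real M * (nrm 1)\<^sup>2 / J + (nrm 1 * sqrt (2 * E J + 2 * E M) + E M))"
    proof (intro add_mono norm_ip_one_diff_avg_shift that)
      have "norm (ip 1 (avg_shift J * (1 - X ^ 1))) \<le> nrm 1 * nrm (avg_shift J * (1 - X ^ 1))"
        by (rule cauchy_schwarz)
      also have "\<dots> \<le> nrm 1 * (2 * 1 * nrm 1 / J)"
        using nrm_avg_shift_diff[of J 1] by (intro mult_left_mono nrm_nonneg) simp
      finally show "norm (ip 1 (avg_shift J * (1 - X ^ 1))) \<le> 2 * (nrm 1)\<^sup>2 / J"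
        by (simp add: power2_eq_square mult_ac)
      have "norm (ip (avg_shift M) (avg_shift J - avg_shift M)) \<le> nrm (avg_shift M) * nrm (avg_shift J - avg_shift M)"
        by (rule cauchy_schwarz)
      also have "\<dots> \<le> nrm 1 * sqrt (2 * E J + 2 * E M)"
        using nrm_avg_shift_mult[OF that(2), of 1] nrm_avg_shift_cauchy[OF that]
        by (intro mult_mono real_le_rsqrt nrm_nonneg) (simp_all add: E_def)
      finally show "norm (ip (avg_shift M) (avg_shift J - avg_shift M)) \<le> nrm 1 * sqrt (2 * E J + 2 * E M)" .
      show "norm (of_real (E M) :: complex) \<le> E M" using E0[OF that(2)] by simp
    qed
    finally show ?thesis .
  qed
  show ?thesis unfolding avg
  proof (rule tendstoI)
    fix e :: real assume e: "e > 0"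
    have "(\<lambda>M. nrm 1 * sqrt (2 * 0 + 2 * E M) + E M) \<longlonglongrightarrow> nrm 1 * sqrt (2 * 0 + 2 * 0) + 0"
      by (intro tendsto_intros E)
    then have "\<forall>\<^sub>F M in sequentially. nrm 1 * sqrt (2 * 0 + 2 * E M) + E M < e"
      using e by (intro order_tendstoD) auto
    with eventually_gt_at_top[of 0] obtain M where M: "M > 0" "nrm 1 * sqrt (2 * 0 + 2 * E M) + E M < e"
      by (metis (mono_tags, lifting) eventually_conj eventually_happens sequentially_bot)
    have "(\<lambda>J. 2 * (nrm 1)\<^sup>2 / real J + (2 * real M * (nrm 1)\<^sup>2 / real J + (nrm 1 * sqrt (2 * E J + 2 * E M) + E M)))
      \<longlonglongrightarrow> 0 + (0 + (nrm 1 * sqrt (2 * 0 + 2 * E M) + E M))"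
      by (intro tendsto_intros E tendsto_divide_0[OF tendsto_const] filterlim_real_sequentially
          filterlim_at_top_imp_at_infinity)
    then have "\<forall>\<^sub>F J in sequentially. 2 * (nrm 1)\<^sup>2 / real J + (2 * real M * (nrm 1)\<^sup>2 / real J
        + (nrm 1 * sqrt (2 * E J + 2 * E M) + E M)) < e"
      using M(2) by (intro order_tendstoD) auto
    with eventually_gt_at_top[of 0]
    show "\<forall>\<^sub>F J in sequentially. dist (ip 1 (X * avg_shift J)) (of_real (inf_nrm\<^sup>2)) < e"
    proof eventually_elim
      case (elim J)
      from le_less_trans[OF bound[OF elim(1) M(1)] elim(2)] show ?case by (simp only: dist_norm)
    qed
  qed
qed

lemma nrm_avg_shift_squared:
  "(nrm (avg_shift J))\<^sup>2 = Re (\<Sum>i<J. \<Sum>j<J. K i j) / (real J)\<^sup>2"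
proof -
  have "ip (avg_shift J) (avg_shift J) = (\<Sum>i<J. \<Sum>j<J. K i j) / (of_nat J)\<^sup>2"
    by (simp add: avg_shift_def ip_smult_left ip_smult_right ip_sum_left ip_sum_right ip_X_power power2_eq_square
        sum_divide_distrib) (rule sum.swap)
  also have "\<dots> = (\<Sum>i<J. \<Sum>j<J. K i j) / of_real ((real J)\<^sup>2)" by simp
  finally have "Re (ip (avg_shift J) (avg_shift J)) = Re (\<Sum>i<J. \<Sum>j<J. K i j) / (real J)\<^sup>2"
    by (simp only: Re_divide_of_real)
  then show ?thesis by (simp add: ip_self)
qed

lemma inf_nrm_squared_ge:
  assumes "\<And>J. J > 0 \<Longrightarrow> c \<le> Re (\<Sum>i<J. \<Sum>j<J. K i j) / (real J)\<^sup>2"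
  shows "c \<le> inf_nrm\<^sup>2"
proof (rule tendsto_lowerbound[OF _ _ sequentially_bot])
  show "(\<lambda>J. (nrm (avg_shift J))\<^sup>2) \<longlonglongrightarrow> inf_nrm\<^sup>2"
    by (intro tendsto_intros nrm_avg_shift_tendsto)
  show "\<forall>\<^sub>F J in sequentially. c \<le> (nrm (avg_shift J))\<^sup>2"
    using eventually_gt_at_top[of 0]
    by eventually_elim (simp only: nrm_avg_shift_squared assms)
qed

end

section \<open>Nonvanishing means of pretentious functions\<close>

definition multiplicative_span :: "nat set \<Rightarrow> nat set" where
  "multiplicative_span P = {n. n > 0 \<and> prime_factors n \<subseteq> P}"

lemma multiplicative_span_insert:
  assumes p: "prime p" "p \<notin> P"
  shows "bij_betw (\<lambda>(k, m). p ^ k * m) (UNIV \<times> multiplicative_span P) (multiplicative_span (insert p P))"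
proof (rule bij_betwI')
  have ndvd: "\<not> p dvd m" if "m \<in> multiplicative_span P" for m
    using that p by (auto simp: multiplicative_span_def in_prime_factors_iff)
  have mult: "multiplicity p (p ^ k * m) = k" if "m \<in> multiplicative_span P" for k m
    using that p ndvd[OF that]
    by (subst prime_elem_multiplicity_mult_distrib) (auto simp: multiplicative_span_def not_dvd_imp_multiplicity_0)
  fix x y assume x: "x \<in> (UNIV :: nat set) \<times> multiplicative_span P"
    and y: "y \<in> (UNIV :: nat set) \<times> multiplicative_span P"
  obtain k m k' m' where xy: "x = (k, m)" "y = (k', m')" by fastforce
  show "((case x of (k, m) \<Rightarrow> p ^ k * m) = (case y of (k, m) \<Rightarrow> p ^ k * m)) = (x = y)"
  proof
    assume eq: "(case x of (k, m) \<Rightarrow> p ^ k * m) = (case y of (k, m) \<Rightarrow> p ^ k * m)"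
    then have "k = k'" using mult[of m k] mult[of m' k'] x y xy by simp
    with eq show "x = y" using p xy by (simp add: prime_gt_0_nat)
  qed auto
next
  fix x assume "x \<in> (UNIV :: nat set) \<times> multiplicative_span P"
  then obtain k m where x: "x = (k, m)" "m \<in> multiplicative_span P" by auto
  then show "(case x of (k, m) \<Rightarrow> p ^ k * m) \<in> multiplicative_span (insert p P)"
    using p by (auto simp: multiplicative_span_def prime_factors_product prime_gt_0_nat
        prime_factorization_prime_power split: if_splits dest!: prime_dvd_power
        simp: in_prime_factors_iff primes_dvd_imp_eq prime_dvd_mult_iff)
next
  fix n assume n: "n \<in> multiplicative_span (insert p P)"
  then have "n \<noteq> 0" by (simp add: multiplicative_span_def)
  then obtain m where m: "n = p ^ multiplicity p n * m" "\<not> p dvd m"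
    using multiplicity_decompose'[of n p] p by (auto simp: prime_nat_iff)
  have "m \<in> multiplicative_span P"
    unfolding multiplicative_span_def
  proof (intro CollectI conjI subsetI)
    show "m > 0" using m(2) by (cases m) auto
    fix q assume q: "q \<in> prime_factors m"
    then have "q \<in> prime_factors n" using \<open>n \<noteq> 0\<close> m(1)
      by (metis dvd_mult in_prime_factors_iff)
    then show "q \<in> P" using n q m(2) by (auto simp: multiplicative_span_def)
  qed
  with m(1) show "\<exists>x\<in>UNIV \<times> multiplicative_span P. n = (case x of (k, m) \<Rightarrow> p ^ k * m)"
    by (intro bexI[of _ "(multiplicity p n, m)"]) auto
qed

text \<open>Each new prime \<open>p\<close> splits off a factor because \<open>n = p ^ k * m\<close>
  uniquely with \<open>m\<close> in the smaller span. Infinite products are avoided: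
  \<open>infsum_le_of_exhaustion\<close> passes from finite sets of primes to all integers
  concerned.\<close>

lemma euler_product_finite:
  fixes h :: "nat \<Rightarrow> 'a :: {real_normed_field, banach}"
  assumes h1: "h 1 = 1"
    and mult: "\<And>m n. m > 0 \<Longrightarrow> n > 0 \<Longrightarrow> coprime m n \<Longrightarrow> h (m * n) = h m * h n"
    and sm: "(\<lambda>n. norm (h n)) summable_on UNIV"
    and P: "finite P" "\<And>p. p \<in> P \<Longrightarrow> prime p"
  shows "infsum h (multiplicative_span P) = (\<Prod>p\<in>P. \<Sum>\<^sub>\<infinity>k. h (p ^ k))"
  using P
proof (induction P rule: finite_induct)
  case empty
  have "multiplicative_span {} = {1}"
    by (auto simp: multiplicative_span_def prime_factorization_empty_iff)
  then show ?case using h1 by simp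
next
  case (insert p P)
  let ?S = "multiplicative_span P"
  have p: "prime p" using insert by auto
  have bij: "bij_betw (\<lambda>(k, m). p ^ k * m) (UNIV \<times> ?S) (multiplicative_span (insert p P))"
    by (rule multiplicative_span_insert[OF p insert.hyps(2)])
  have eq: "h (p ^ k * m) = h (p ^ k) * h m" if "m \<in> ?S" for k m
  proof (rule mult)
    have "\<not> p dvd m"
      using that p insert.hyps(2) by (auto simp: multiplicative_span_def in_prime_factors_iff)
    then show "coprime (p ^ k) m" using p by (simp add: prime_imp_coprime)
  qed (use that p in \<open>auto simp: multiplicative_span_def prime_gt_0_nat\<close>)
  have "h summable_on multiplicative_span (insert p P)"
    using summable_on_subset_banach[OF abs_summable_summable[OF sm]] by blast
  then have "(\<lambda>x. h (case x of (k, m) \<Rightarrow> p ^ k * m)) summable_on UNIV \<times> ?S"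
    by (subst summable_on_reindex_bij_betw[OF bij])
  then have sm2: "(\<lambda>(k, m). h (p ^ k * m)) summable_on UNIV \<times> ?S"
    by (simp add: case_prod_unfold)
  have "infsum h (multiplicative_span (insert p P)) = (\<Sum>\<^sub>\<infinity>x\<in>UNIV \<times> ?S. h (case x of (k, m) \<Rightarrow> p ^ k * m))"
    by (rule infsum_reindex_bij_betw[OF bij, symmetric])
  also have "\<dots> = (\<Sum>\<^sub>\<infinity>(k, m)\<in>UNIV \<times> ?S. h (p ^ k * m))"
    by (simp add: case_prod_unfold)
  also have "\<dots> = (\<Sum>\<^sub>\<infinity>k. \<Sum>\<^sub>\<infinity>m\<in>?S. h (p ^ k * m))"
    by (rule infsum_Sigma'_banach[OF sm2, symmetric])
  also have "\<dots> = (\<Sum>\<^sub>\<infinity>k. h (p ^ k) * infsum h ?S)"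
    by (intro infsum_cong) (simp add: eq infsum_cmult_right' cong: infsum_cong)
  also have "\<dots> = (\<Sum>\<^sub>\<infinity>k. h (p ^ k)) * infsum h ?S"
    by (rule infsum_cmult_left')
  finally show ?case using insert by simp
qed

text \<open>To be used with \<open>x = p^(-s)\<close> and \<open>z = g(p)\<close>. Terms with
  \<open>k \<ge> 2\<close> are bounded by the geometric tail \<open>x^2 / (1 - x)\<close>.
  Multiplying \<open>1 + x * Re z - x^2 / (1 - x)\<close> by \<open>1 - x\<close> loses one
  \<open>x^2\<close> from this tail and at most another from the product of \<open>x * Re z\<close>
  with \<open>- x\<close>.\<close>

lemma local_factor_lower_bound:
  fixes h :: "nat \<Rightarrow> complex"
  assumes x: "0 \<le> x" "x < 1" and h: "h 0 = 1" "h 1 = z * of_real x" "\<And>k. norm (h k) \<le> x ^ k"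
  shows "(1 - (x * (1 - Re z) + 2 * x\<^sup>2)) * (\<Sum>\<^sub>\<infinity>k. x ^ k) \<le> norm (\<Sum>\<^sub>\<infinity>k. h k)"
proof -
  have geo: "summable (\<lambda>k. x ^ k)" using x by simp
  have "(\<lambda>n. norm (h n)) summable_on UNIV"
    by (rule norm_summable_imp_summable_on, rule summable_comparison_test'[OF geo]) (use h(3) in auto)
  then have "(\<lambda>k. h k) sums (\<Sum>\<^sub>\<infinity>k. h k)"
    by (rule has_sum_imp_sums[OF has_sum_infsum[OF abs_summable_summable]])
  then have sh: "summable h" "suminf h = (\<Sum>\<^sub>\<infinity>k. h k)" by (auto simp: sums_iff)
  have gs: "(\<Sum>\<^sub>\<infinity>k. x ^ k) = 1 / (1 - x)"
  proof -
    have "(\<lambda>k. x ^ k) summable_on UNIV"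
      by (rule norm_summable_imp_summable_on) (use x geo in simp)
    then have "(\<lambda>k. x ^ k) sums (\<Sum>\<^sub>\<infinity>k. x ^ k)" by (intro has_sum_imp_sums has_sum_infsum)
    then show ?thesis using geometric_sums[of x] x sums_unique2 by fastforce
  qed
  have tail: "norm (\<Sum>k. h (k + 2)) \<le> x\<^sup>2 / (1 - x)"
  proof -
    have s2: "(\<lambda>k. x ^ (k + 2)) sums (x\<^sup>2 * (1 / (1 - x)))"
      using sums_mult[OF geometric_sums[of x], of "x\<^sup>2"] x by (simp add: power_add mult_ac power2_eq_square)
    have "norm (\<Sum>k. h (k + 2)) \<le> (\<Sum>k. x ^ (k + 2))"
      by (rule norm_suminf_le[OF h(3)]) (use s2 in \<open>simp only: sums_iff\<close>)
    then show ?thesis using s2 by (simp add: sums_iff)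
  qed
  have "(\<Sum>\<^sub>\<infinity>k. h k) = (\<Sum>k. h (k + 2)) + (\<Sum>k<2. h k)"
    unfolding sh(2)[symmetric] by (rule suminf_split_initial_segment[OF sh(1)])
  also have "(\<Sum>k<2. h k) = 1 + z * of_real x"
    using h by (simp add: numeral_2_eq_2)
  finally have "norm (\<Sum>\<^sub>\<infinity>k. h k) \<ge> norm (1 + z * of_real x) - norm (\<Sum>k. h (k + 2))"
    by (metis add.commute norm_diff_ineq)
  moreover have "norm (1 + z * of_real x) \<ge> 1 + x * Re z"
    using complex_Re_le_cmod[of "1 + z * of_real x"] by (simp add: mult.commute)
  ultimately have lower: "norm (\<Sum>\<^sub>\<infinity>k. h k) \<ge> 1 + x * Re z - x\<^sup>2 / (1 - x)"
    using tail by linarith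
  have z1: "Re z * x \<le> x"
    using h(3)[of 1] h(2) x complex_Re_le_cmod[of "z * of_real x"] by simp
  have "(1 - (x * (1 - Re z) + 2 * x\<^sup>2)) \<le> (1 + x * Re z) * (1 - x) - x\<^sup>2"
  proof -
    have "x * (Re z * x) \<le> x * x" using x z1 by (intro mult_left_mono) auto
    then show ?thesis by (simp add: algebra_simps power2_eq_square)
  qed
  then have "(1 - (x * (1 - Re z) + 2 * x\<^sup>2)) / (1 - x) \<le> ((1 + x * Re z) * (1 - x) - x\<^sup>2) / (1 - x)"
    using x by (intro divide_right_mono) auto
  also have "\<dots> = 1 + x * Re z - x\<^sup>2 / (1 - x)" using x by (simp add: diff_divide_distrib)
  finally show ?thesis using lower unfolding gs by simp
qed

lemma one_minus_sum_le_prod: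
  fixes u :: "'a \<Rightarrow> real"
  assumes "finite A" "\<And>x. x \<in> A \<Longrightarrow> 0 \<le> u x \<and> u x \<le> 1"
  shows "1 - sum u A \<le> (\<Prod>x\<in>A. 1 - u x)"
  using assms
proof (induction A rule: finite_induct)
  case (insert x A)
  have "(\<Prod>x\<in>A. 1 - u x) \<le> 1" by (intro prod_le_1) (use insert in auto)
  then have "u x * (\<Prod>x\<in>A. 1 - u x) \<le> u x * 1" using insert by (intro mult_left_mono) auto
  with insert show ?case by (simp add: algebra_simps)
qed simp

text \<open>The inequality is known for the spans of finite sets of primes, which exhaust
  \<open>T\<close>. A set \<open>U\<close> containing a large finite \<open>F\<close> misses at most
  \<open>d\<close> of the sum of \<open>b\<close>, and hence at most \<open>d\<close> of the sum of
  \<open>h\<close>; with the factor \<open>c\<close> the total loss is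
  \<open>(c + 1) * d = e\<close>.\<close>

lemma infsum_le_of_exhaustion:
  fixes h :: "'a \<Rightarrow> complex" and b :: "'a \<Rightarrow> real"
  assumes b: "b summable_on T" and h: "\<And>x. x \<in> T \<Longrightarrow> norm (h x) \<le> b x" and c: "c \<ge> 0"
    and ex: "\<And>F. finite F \<Longrightarrow> F \<subseteq> T \<Longrightarrow> \<exists>U. F \<subseteq> U \<and> U \<subseteq> T \<and> infsum b U \<le> c * norm (infsum h U)"
  shows "infsum b T \<le> c * norm (infsum h T)"
proof (rule field_le_epsilon)
  fix e :: real assume e: "e > 0"
  define d where "d = e / (c + 1)"
  have d: "d > 0" using e c by (simp add: d_def)
  have b0: "b x \<ge> 0" if "x \<in> T" for x using h[OF that] norm_ge_zero order_trans by blast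
  obtain F where F: "finite F" "F \<subseteq> T" "dist (sum b F) (infsum b T) \<le> d"
    using infsum_finite_approximation[OF b d] by auto
  obtain U where U: "F \<subseteq> U" "U \<subseteq> T" "infsum b U \<le> c * norm (infsum h U)"
    using ex[OF F(1,2)] by auto
  have bU: "b summable_on U" and bTU: "b summable_on (T - U)"
    using summable_on_subset_banach[OF b] U(2) by auto
  have hT: "(\<lambda>n. norm (h n)) summable_on T" by (rule Infinite_Sum.abs_summable_on_comparison_test'[OF b h])
  then have habs: "(\<lambda>n. norm (h n)) summable_on U" "(\<lambda>n. norm (h n)) summable_on (T - U)"
    using U(2) by (auto intro: summable_on_subset_banach[OF hT])
  have splitb: "infsum b T = infsum b U + infsum b (T - U)"
    using infsum_Un_disjoint[OF bU bTU] U(2) by (simp add: Un_absorb1)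
  have splith: "infsum h T = infsum h U + infsum h (T - U)"
    using infsum_Un_disjoint[OF abs_summable_summable[OF habs(1)] abs_summable_summable[OF habs(2)]] U(2)
    by (simp add: Un_absorb1)
  have "sum b F \<le> infsum b U"
    by (rule finite_sum_le_infsum[OF bU F(1) U(1)]) (use b0 U(2) in auto)
  then have small: "infsum b (T - U) \<le> d" using F(3) splitb by (simp add: dist_real_def)
  have "norm (infsum h (T - U)) \<le> infsum b (T - U)"
    by (rule norm_infsum_le[OF has_sum_infsum has_sum_infsum[OF bTU]])
       (use habs(2) abs_summable_summable h in auto)
  then have "norm (infsum h U) \<le> norm (infsum h T) + d"
    using small splith norm_triangle_ineq4[of "infsum h T" "infsum h (T - U)"] by simp
  then have "c * norm (infsum h U) \<le> c * (norm (infsum h T) + d)" using c by (rule mult_left_mono)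
  then have "infsum b T \<le> c * norm (infsum h T) + (c + 1) * d"
    using U(3) small splitb by (simp add: algebra_simps)
  then show "infsum b T \<le> c * norm (infsum h T) + e" using c by (simp add: d_def)
qed

section \<open>Partial summation and comparison with the zeta function\<close>

lemma abel_summation:
  fixes a :: "nat \<Rightarrow> 'a :: {real_algebra_1, comm_ring_1}"
  shows "(\<Sum>k=1..Suc m. of_real (w k) * a k) = of_real (w (Suc m)) * (\<Sum>k=1..Suc m. a k)
    + (\<Sum>n=1..m. of_real (w n - w (Suc n)) * (\<Sum>k=1..n. a k))"
  by (induction m) (simp_all add: algebra_simps)

text \<open>Abel's identity expresses both weighted sums through partial sums with the same
  nonnegative coefficients. The weights decrease from 1 on only, since in the application
  \<open>0 powr - s\<close> is 0.\<close>

lemma abel_summation_bound: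
  fixes g :: "nat \<Rightarrow> complex" and w t :: "nat \<Rightarrow> real"
  assumes S: "\<And>n. norm (\<Sum>k=1..n. g k) \<le> (\<Sum>k=1..n. t k)"
    and w: "\<And>n. n > 0 \<Longrightarrow> w (Suc n) \<le> w n" "\<And>n. 0 \<le> w n"
  shows "norm (\<Sum>k=1..n. of_real (w k) * g k) \<le> (\<Sum>k=1..n. w k * t k)"
proof (cases n)
  case (Suc m)
  have "norm (\<Sum>k=1..Suc m. of_real (w k) * g k)
      \<le> norm (of_real (w (Suc m)) * (\<Sum>k=1..Suc m. g k))
        + (\<Sum>n=1..m. norm (of_real (w n - w (Suc n)) * (\<Sum>k=1..n. g k)))"
    unfolding abel_summation by (intro order_trans[OF norm_triangle_ineq] add_left_mono norm_sum)
  also have "\<dots> \<le> w (Suc m) * (\<Sum>k=1..Suc m. t k) + (\<Sum>n=1..m. (w n - w (Suc n)) * (\<Sum>k=1..n. t k))"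
    unfolding norm_mult norm_of_real using w
    by (intro add_mono sum_mono mult_mono S) (auto intro: sum_nonneg order_trans[OF norm_ge_zero S])
  also have "\<dots> = (\<Sum>k=1..Suc m. w k * t k)" using abel_summation[of w t m] by simp
  finally show ?thesis using Suc by simp
qed simp

theorem mean_not_tendsto_0:
  fixes g :: "nat \<Rightarrow> complex" and Q :: nat
  assumes Q: "Q > 0" and g1: "g 1 = 1"
    and mult: "\<And>m n. m > 0 \<Longrightarrow> n > 0 \<Longrightarrow> coprime m n \<Longrightarrow> g (m * n) = g m * g n"
    and bound: "\<And>n. n > 0 \<Longrightarrow> norm (g n) \<le> 1"
    and zero: "\<And>n. \<not> coprime n Q \<Longrightarrow> g n = 0"
    and small: "\<And>P. finite P \<Longrightarrow> (\<And>p. p \<in> P \<Longrightarrow> prime p \<and> \<not> p dvd Q) \<Longrightarrow>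
      (\<Sum>p\<in>P. (1 - Re (g p)) / real p + 2 / (real p)\<^sup>2) \<le> 1 / 2"
  shows "\<not> (\<lambda>N. 1 / of_nat N * (\<Sum>n=1..N. g n)) \<longlonglongrightarrow> 0"
proof
  assume lim: "(\<lambda>N. 1 / of_nat N * (\<Sum>n=1..N. g n)) \<longlonglongrightarrow> 0"
  \<comment> \<open>Chosen so that \<open>2 * \<epsilon> * \<zeta>\<close> is half of
    \<open>\<zeta> / Q^2\<close>, the lower bound coming from the Euler product; the other half
    gives \<open>\<zeta> \<le> 4 * C * Q^2\<close>.\<close>
  define \<epsilon> where "\<epsilon> = 1 / (4 * (real Q)\<^sup>2)"
  have \<epsilon>: "\<epsilon> > 0" using Q by (simp add: \<epsilon>_def)
  from tendstoD[OF lim \<epsilon>] obtain n0 where n0: "\<And>n. n \<ge> n0 \<Longrightarrow> norm (1 / of_nat n * (\<Sum>k=1..n. g k)) < \<epsilon>"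
    by (auto simp: eventually_sequentially)
  define C where "C = real n0"
  \<comment> \<open>The partial sums \<open>n * \<epsilon> + C\<close> of \<open>t\<close> dominate
    those of \<open>g\<close>. All of \<open>C\<close> sits at \<open>k = 1\<close>, where the
    weight \<open>k powr - s\<close> is 1, so that its contribution does not depend on
    \<open>s\<close>.\<close>
  define t where "t k = \<epsilon> + (if k = 1 then C else 0)" for k :: nat
  have S: "norm (\<Sum>k=1..n. g k) \<le> (\<Sum>k=1..n. t k)" for n
  proof (cases "n = 0")
    case False
    then have t: "(\<Sum>k=1..n. t k) = n * \<epsilon> + C" by (simp add: t_def sum.distrib)
    show ?thesis
    proof (cases "n \<ge> n0")
      case True
      have "norm (\<Sum>k=1..n. g k) = n * norm (1 / of_nat n * (\<Sum>k=1..n. g k))"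
        using False by (simp add: norm_mult norm_divide)
      also have "\<dots> \<le> n * \<epsilon>" using n0[OF True] by (intro mult_left_mono) auto
      finally show ?thesis using t by (simp add: C_def)
    next
      case False
      have "norm (\<Sum>k=1..n. g k) \<le> (\<Sum>k=1..n. 1)"
        by (intro order_trans[OF norm_sum] sum_mono bound) auto
      also have "\<dots> \<le> C" using False by (simp add: C_def)
      finally show ?thesis using t \<epsilon> by (simp add: add_increasing)
    qed
  qed simp
  \<comment> \<open>The bound has to be uniform in \<open>s\<close>; the restriction
    \<open>s \<le> 2\<close> serves to bound \<open>Q^(-s)\<close> below by
    \<open>Q^(-2)\<close>.\<close>
  have zeta_bound: "(\<Sum>k=1..N. real k powr - s) \<le> 4 * C * (real Q)\<^sup>2" if s: "1 < s" "s \<le> 2" for s N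
  proof -
    define b where "b n = real n powr - s" for n :: nat
    define h where "h n = of_real (b n) * g n" for n
    define \<zeta> where "\<zeta> = infsum b UNIV"
    have b0: "b n \<ge> 0" for n by (simp add: b_def)
    have sb: "b summable_on UNIV"
      using summable_real_powr_iff[of "- s"] s unfolding b_def
      by (subst summable_on_UNIV_nonneg_real_iff) auto
    have hb: "norm (h n) \<le> b n" for n
      using bound[of n] b0[of n] by (cases "n = 0") (auto simp: h_def norm_mult b_def mult_left_le)
    have sh: "(\<lambda>n. norm (h n)) summable_on UNIV"
      by (rule Infinite_Sum.abs_summable_on_comparison_test'[OF sb hb])
    have h0: "h 0 = 0" by (simp add: h_def b_def)
    have b1: "b 1 = 1" by (simp add: b_def)
    have h1: "h 1 = 1" using b1 g1 by (simp add: h_def)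
    have bmult: "b (m * n) = b m * b n" for m n by (simp add: b_def powr_mult)
    have hmult: "h (m * n) = h m * h n" if "m > 0" "n > 0" "coprime m n" for m n
      using mult[OF that] by (simp add: h_def bmult)
    define T where "T = {n. n > 0 \<and> coprime n Q}"
    have upper: "norm (infsum h T) \<le> C + \<epsilon> * \<zeta>"
    proof -
      have "norm (\<Sum>k<Suc n. h k) \<le> C + \<epsilon> * \<zeta>" for n
      proof -
        have "(\<Sum>k<Suc n. h k) = (\<Sum>k=1..n. of_real (b k) * g k)"
          unfolding h_def[symmetric] using h0
          by (intro sum.mono_neutral_cong_right) (auto simp: not_le)
        also have "norm \<dots> \<le> (\<Sum>k=1..n. b k * t k)"
          by (rule abel_summation_bound[OF S]) (use s in \<open>auto simp: b_def intro!: powr_mono2'\<close>)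
        also have "\<dots> = (\<Sum>k=1..n. if k = 1 then C else 0) + \<epsilon> * (\<Sum>k=1..n. b k)"
          using b1 by (simp add: t_def algebra_simps sum.distrib sum_distrib_left if_distrib[of "(*) _"]
              cong: if_cong)
        also have "\<dots> \<le> C + \<epsilon> * \<zeta>"
          unfolding \<zeta>_def using \<epsilon> b0
          by (intro add_mono mult_left_mono finite_sum_le_infsum[OF sb]) (auto simp: C_def)
        finally show ?thesis .
      qed
      moreover have "(\<lambda>n. \<Sum>k<Suc n. h k) \<longlonglongrightarrow> infsum h UNIV"
        using has_sum_imp_sums[OF has_sum_infsum[OF abs_summable_summable[OF sh]]]
        unfolding sums_def by (rule LIMSEQ_Suc)
      ultimately have "norm (infsum h UNIV) \<le> C + \<epsilon> * \<zeta>"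
        by (intro Lim_norm_ubound[OF sequentially_bot]) auto
      moreover have "infsum h UNIV = infsum h T"
        using h0 zero by (intro infsum_cong_neutral) (auto simp: T_def h_def)
      ultimately show ?thesis by simp
    qed
    \<comment> \<open>The factor 2 comes from \<open>small\<close>: the product of the
      \<open>1 - a p\<close> is at least \<open>1 - 1/2\<close> for every finite set of primes not
      dividing \<open>Q\<close>.\<close>
    have "infsum b T \<le> 2 * norm (infsum h T)"
    proof (rule infsum_le_of_exhaustion[OF _ hb])
      show "b summable_on T" by (rule summable_on_subset_banach[OF sb]) simp
      fix F assume F: "finite F" "F \<subseteq> T"
      define P where "P = (\<Union>n\<in>F. prime_factors n)"
      have P: "finite P" "\<And>p. p \<in> P \<Longrightarrow> prime p \<and> \<not> p dvd Q"
      proof -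
        show "finite P" using F(1) by (simp add: P_def)
        fix p assume "p \<in> P"
        then obtain n where n: "n \<in> F" "prime p" "p dvd n" by (auto simp: P_def in_prime_factors_iff)
        then have "coprime n Q" using F(2) by (auto simp: T_def)
        then show "prime p \<and> \<not> p dvd Q" using n coprime_common_divisor_nat[of n Q p] by (auto simp: prime_nat_iff)
      qed
      have "infsum b (multiplicative_span P) \<le> 2 * norm (infsum h (multiplicative_span P))"
      proof -
        define a where "a p = b p * (1 - Re (g p)) + 2 * (b p)\<^sup>2" for p
        have pp: "prime p" "real p > 1" "p > 0" if "p \<in> P" for p
          using P(2)[OF that] prime_gt_1_nat[of p] by auto
        have bp: "0 \<le> b p" "b p \<le> 1 / p" "b p < 1" if "p \<in> P" for p
        proof -
          show "b p \<le> 1 / p"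
            using s pp[OF that] powr_mono[of "- s" "- 1" "real p"]
            by (simp add: b_def powr_minus_divide)
          also have "\<dots> < 1" using pp[OF that] by simp
          finally show "b p < 1" .
        qed (rule b0)
        have a0: "0 \<le> a p" "a p \<le> (1 - Re (g p)) / real p + 2 / (real p)\<^sup>2" if "p \<in> P" for p
        proof -
          have g: "Re (g p) \<le> 1" using bound[OF pp(3)[OF that]] complex_Re_le_cmod[of "g p"] by linarith
          then show "0 \<le> a p" using b0[of p] by (simp add: a_def)
          have "b p * (1 - Re (g p)) \<le> 1 / real p * (1 - Re (g p))"
            by (intro mult_right_mono bp that) (use g in simp)
          moreover have "(b p)\<^sup>2 \<le> (1 / real p)\<^sup>2" by (intro power_mono bp that)
          ultimately show "a p \<le> (1 - Re (g p)) / real p + 2 / (real p)\<^sup>2"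
            by (simp add: a_def power_divide)
        qed
        have sa: "sum a P \<le> 1 / 2"
          by (rule order_trans[OF sum_mono small[OF P]]) (use a0(2) in auto)
        have a1: "a p \<le> 1" if "p \<in> P" for p
          using member_le_sum[of p P a] a0(1) P(1) that sa by force
        have bpk: "b (p ^ k) = b p ^ k" for p k
          by (induction k) (simp_all add: bmult b1[simplified])
        have local: "(1 - a p) * (\<Sum>\<^sub>\<infinity>k. b (p ^ k)) \<le> norm (\<Sum>\<^sub>\<infinity>k. h (p ^ k))" if "p \<in> P" for p
        proof -
          have "(1 - (b p * (1 - Re (g p)) + 2 * (b p)\<^sup>2)) * (\<Sum>\<^sub>\<infinity>k. b p ^ k) \<le> norm (\<Sum>\<^sub>\<infinity>k. h (p ^ k))"
          proof (rule local_factor_lower_bound)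
            show "norm (h (p ^ k)) \<le> b p ^ k" for k using hb[of "p ^ k"] by (simp add: bpk)
          qed (use bp[OF that] h1 in \<open>auto simp: h_def\<close>)
          then show ?thesis by (simp add: a_def bpk)
        qed
        have Z0: "0 \<le> (\<Sum>\<^sub>\<infinity>k. b (p ^ k))" for p by (intro infsum_nonneg b0)
        have "infsum b (multiplicative_span P) = (\<Prod>p\<in>P. \<Sum>\<^sub>\<infinity>k. b (p ^ k))"
          by (rule euler_product_finite[OF b1 bmult _ P(1)]) (use sb b0 P(2) in auto)
        moreover have "1 / 2 * (\<Prod>p\<in>P. \<Sum>\<^sub>\<infinity>k. b (p ^ k)) \<le> (\<Prod>p\<in>P. 1 - a p) * (\<Prod>p\<in>P. \<Sum>\<^sub>\<infinity>k. b (p ^ k))"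
          using one_minus_sum_le_prod[OF P(1), of a] a0(1) a1 sa
          by (intro mult_right_mono prod_nonneg ballI Z0) auto
        moreover have "\<dots> \<le> (\<Prod>p\<in>P. norm (\<Sum>\<^sub>\<infinity>k. h (p ^ k)))"
          unfolding prod.distrib[symmetric]
          by (intro prod_mono conjI local mult_nonneg_nonneg Z0) (use a1 in auto)
        moreover have "\<dots> = norm (infsum h (multiplicative_span P))"
          unfolding prod_norm
          by (subst euler_product_finite[OF h1 hmult sh P(1)]) (use P(2) in auto)
        ultimately show ?thesis by linarith
      qed
      moreover have "F \<subseteq> multiplicative_span P"
        using F(2) by (auto simp: multiplicative_span_def P_def T_def)
      moreover have "multiplicative_span P \<subseteq> T"
      proof
        fix n assume n: "n \<in> multiplicative_span P"
        have "coprime n Q"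
        proof (rule ccontr)
          assume "\<not> coprime n Q"
          then obtain p where "prime p" "p dvd n" "p dvd Q"
            by (metis coprime_iff_gcd_eq_1 gcd_nat.bounded_iff prime_factor_nat)
          then show False using n P(2)[of p] by (auto simp: multiplicative_span_def in_prime_factors_iff)
        qed
        then show "n \<in> T" using n by (simp add: T_def multiplicative_span_def)
      qed
      ultimately show "\<exists>U. F \<subseteq> U \<and> U \<subseteq> T \<and> infsum b U \<le> 2 * norm (infsum h U)" by blast
    qed simp
    moreover have "real Q powr - s * \<zeta> \<le> infsum b T"
    proof -
      \<comment> \<open>The progression 1 modulo \<open>Q\<close> lies in \<open>T\<close>, and its
        \<open>n\<close>-th member is at most \<open>Q * n\<close>, so it already carries
        \<open>Q^(-s)\<close> times the full zeta sum.\<close>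
      define j where "j n = (n - 1) * Q + 1" for n :: nat
      have inj: "inj_on j {0<..}"
        using Q by (auto simp: inj_on_def j_def)
      have "coprime (j n) Q" for n
        using gcd_add_mult[of Q "n - 1" 1] by (simp add: j_def coprime_iff_gcd_eq_1 gcd.commute)
      then have jT: "j ` {0<..} \<subseteq> T" by (auto simp: T_def j_def)
      have sj: "b summable_on j ` {0<..}" by (rule summable_on_subset_banach[OF sb]) simp
      have "\<zeta> = infsum b {0<..}"
        unfolding \<zeta>_def by (intro infsum_cong_neutral) (auto simp: b_def)
      then have "real Q powr - s * \<zeta> = b Q * infsum b {0<..}" by (simp add: b_def)
      also have "\<dots> = (\<Sum>\<^sub>\<infinity>n\<in>{0<..}. b (Q * n))" by (simp only: bmult infsum_cmult_right')
      also have "\<dots> \<le> (\<Sum>\<^sub>\<infinity>n\<in>{0<..}. b (j n))"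
      proof (rule infsum_mono)
        show "(\<lambda>n. b (Q * n)) summable_on {0<..}"
          unfolding bmult by (intro summable_on_cmult_right summable_on_subset_banach[OF sb]) simp
        show "(\<lambda>n. b (j n)) summable_on {0<..}"
          using sj summable_on_reindex[OF inj, of b] by (simp add: o_def)
        fix n :: nat assume "n \<in> {0<..}"
        then obtain m where m: "n = Suc m" by (cases n) auto
        have "j n \<le> Q * n" "j n > 0" using Q m by (auto simp: j_def)
        then show "b (Q * n) \<le> b (j n)"
          unfolding b_def using s by (intro powr_mono2') (simp_all only: of_nat_le_iff of_nat_0_less_iff)
      qed
      also have "\<dots> = infsum b (j ` {0<..})" using infsum_reindex[OF inj, of b] by (simp add: o_def)
      also have "\<dots> \<le> infsum b T"
        by (rule infsum_mono2[OF sj summable_on_subset_banach[OF sb] jT]) (auto simp: b0)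
      finally show ?thesis .
    qed
    moreover have "2 * norm (infsum h T) \<le> 2 * (C + \<epsilon> * \<zeta>)"
      using upper by (rule mult_left_mono) simp
    ultimately have "real Q powr - s * \<zeta> \<le> 2 * (C + \<epsilon> * \<zeta>)"
      by (blast intro: order_trans)
    moreover have "1 / (real Q)\<^sup>2 \<le> real Q powr - s"
    proof -
      have "1 / (real Q)\<^sup>2 = real Q powr - 2" using Q by (simp add: powr_minus_divide powr_numeral)
      also have "\<dots> \<le> real Q powr - s" using Q s by (intro powr_mono) auto
      finally show ?thesis .
    qed
    moreover have "\<zeta> \<ge> 0" unfolding \<zeta>_def by (intro infsum_nonneg b0)
    ultimately have "1 / (real Q)\<^sup>2 * \<zeta> \<le> 2 * (C + \<epsilon> * \<zeta>)"
      by (meson mult_right_mono order_trans)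
    then have "\<zeta> \<le> 4 * C * (real Q)\<^sup>2" using Q by (simp add: \<epsilon>_def field_simps)
    moreover have "(\<Sum>k=1..N. b k) \<le> \<zeta>"
      unfolding \<zeta>_def by (rule finite_sum_le_infsum[OF sb]) (auto simp: b0)
    ultimately show ?thesis by (simp add: b_def)
  qed
  \<comment> \<open>For fixed \<open>N\<close> let \<open>s = 1 + 1/(m+1)\<close>, which stays in
    the range of \<open>zeta_bound\<close>, tend to 1.\<close>
  have "harm N \<le> 4 * C * (real Q)\<^sup>2" for N
  proof -
    have "(\<lambda>m. \<Sum>k=1..N. real k powr - (1 + inverse (real (Suc m)))) \<longlonglongrightarrow> (\<Sum>k=1..N. real k powr - (1 + 0))"
      by (intro tendsto_intros LIMSEQ_inverse_real_of_nat) auto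
    then have "(\<Sum>k=1..N. real k powr - (1 + 0)) \<le> 4 * C * (real Q)\<^sup>2"
    proof (rule LIMSEQ_le_const2)
      show "\<exists>M. \<forall>m\<ge>M. (\<Sum>k=1..N. real k powr - (1 + inverse (real (Suc m)))) \<le> 4 * C * (real Q)\<^sup>2"
        by (intro exI[of _ 0] allI impI zeta_bound) (auto simp: inverse_eq_divide)
    qed
    also have "(\<Sum>k=1..N. real k powr - (1 + 0)) = harm N"
      unfolding harm_def by (intro sum.cong) (auto simp: powr_minus)
    finally show ?thesis .
  qed
  moreover have "\<forall>\<^sub>F N in sequentially. 4 * C * (real Q)\<^sup>2 < harm N"
    using harm_at_top by (simp add: filterlim_at_top_dense)
  ultimately show False
    using eventually_happens[of "\<lambda>N. 4 * C * (real Q)\<^sup>2 < harm N" sequentially] by (auto simp: not_le[symmetric])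
qed

section \<open>Dirichlet characters and the construction of \<open>v\<close>\<close>

lemma dirichlet_character_1:
  assumes "dirichlet_character q \<psi>"
  shows "\<psi> 1 = 1"
proof -
  have "\<psi> (1 * 1) = \<psi> 1 * \<psi> 1" "\<psi> 1 \<noteq> 0"
    using assms unfolding dirichlet_character_def by (blast, simp)
  then show ?thesis by simp
qed

lemma dirichlet_character_periodic:
  assumes "dirichlet_character q \<psi>"
  shows "\<psi> (n + k * q) = \<psi> n"
proof (induction k)
  case (Suc k)
  have "\<psi> (n + k * q + q) = \<psi> (n + k * q)" using assms by (simp add: dirichlet_character_def)
  with Suc show ?case by (simp add: algebra_simps)
qed simp

text \<open>Otherwise the powers of \<open>\<psi> n\<close> would be unbounded, but a periodic function takes finitely
  many values.\<close>

lemma norm_dirichlet_character_le_1: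
  assumes chi: "dirichlet_character q \<psi>"
  shows "norm (\<psi> n) \<le> 1"
proof (rule ccontr)
  assume "\<not> norm (\<psi> n) \<le> 1"
  then have gt: "norm (\<psi> n) > 1" by simp
  have q: "q > 0" using chi by (simp add: dirichlet_character_def)
  have pow: "\<psi> (n ^ k) = \<psi> n ^ k" for k
    using chi dirichlet_character_1[OF chi] by (induction k) (simp_all add: dirichlet_character_def)
  have "\<psi> m = \<psi> (m mod q)" for m
    using dirichlet_character_periodic[OF chi, of "m mod q" "m div q"] by simp
  then have le: "norm (\<psi> m) \<le> Max ((\<lambda>m. norm (\<psi> m)) ` {..<q})" for m
    using q by (metis (no_types, lifting) Max_ge finite_imageI finite_lessThan imageI lessThan_iff mod_less_divisor)
  obtain k where "Max ((\<lambda>m. norm (\<psi> m)) ` {..<q}) < norm (\<psi> n) ^ k"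
    using real_arch_pow[OF gt] by blast
  then show False using le[of "n ^ k"] by (simp add: pow norm_power)
qed

lemma of_nat_powr_imaginary:
  "n > 0 \<Longrightarrow> (of_nat n :: complex) powr (\<i> * of_real t) = cis (t * ln n)"
  by (simp add: powr_def cis_conv_exp mult_ac)

lemma summable_on_small_tail:
  fixes a :: "nat \<Rightarrow> real"
  assumes sm: "a summable_on A" and a0: "\<And>x. x \<in> A \<Longrightarrow> a x \<ge> 0" and e: "e > 0"
  obtains F where "finite F" "F \<subseteq> A"
    "\<And>P. finite P \<Longrightarrow> P \<subseteq> A - F \<Longrightarrow> sum a P \<le> e"
proof -
  obtain F where F: "finite F" "F \<subseteq> A" "dist (sum a F) (infsum a A) \<le> e"
    using infsum_finite_approximation[OF sm e] by auto
  show ?thesis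
  proof (rule that[OF F(1,2)])
    fix P assume P: "finite P" "P \<subseteq> A - F"
    have "sum a (P \<union> F) \<le> infsum a A"
      by (rule finite_sum_le_infsum[OF sm]) (use F P a0 in auto)
    moreover have "sum a (P \<union> F) = sum a P + sum a F"
      by (rule sum.union_disjoint) (use F P in auto)
    ultimately show "sum a P \<le> e" using F(3) by (simp add: dist_real_def)
  qed
qed

lemma pretentious_nonzero_mean_aux:
  assumes f: "f \<in> bounded_multiplicative" "pretentious f" and f1: "f 1 = 1"
  obtains v Q where "Q > 0" "\<And>n. norm (v n) \<le> 1" "(\<lambda>n. v (n + Q) - v n) \<longlonglongrightarrow> 0"
    "\<not> (\<lambda>N. 1 / of_nat N * (\<Sum>n=1..N. f n * v n)) \<longlonglongrightarrow> 0"
proof -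
  have f_le: "norm (f n) \<le> 1" if "n > 0" for n
    using f(1) that by (simp add: bounded_multiplicative_def)
  obtain q \<psi> t where chi: "dirichlet_character q \<psi>" and sm:
    "(\<lambda>p. 1 / real p * (1 - Re (f p * cnj (\<psi> p * of_nat p powr (\<i> * of_real t))))) summable_on {p. prime p}"
    using f(2) unfolding pretentious_def by blast
  define w where "w n = cnj (\<psi> n * of_nat n powr (\<i> * of_real t))" for n
  have q: "q > 0" using chi by (simp add: dirichlet_character_def)
  have w: "w n = cnj (\<psi> n * cis (t * ln n))" if "n > 0" for n
    using that by (simp add: w_def of_nat_powr_imaginary)
  have w_le: "norm (w n) \<le> 1" for n
    using norm_dirichlet_character_le_1[OF chi, of n] by (cases "n = 0") (simp add: w_def, simp add: w norm_mult)
  have fw_le: "norm (f n * w n) \<le> 1" if "n > 0" for n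
    using f_le[OF that] w_le[of n] by (simp add: norm_mult mult_le_one)
  \<comment> \<open>The second term is the error in \<open>local_factor_lower_bound\<close>; it pays
    for the higher powers of \<open>p\<close>, about which pretentiousness says nothing.\<close>
  define a where "a p = (1 - Re (f p * w p)) / real p + 2 / (real p)\<^sup>2" for p
  have "summable (\<lambda>n. 1 / (real n)\<^sup>2)"
    using summable_real_powr_iff[of "-2"] by (simp add: powr_minus_divide)
  then have "(\<lambda>n. 2 * (1 / (real n)\<^sup>2)) summable_on UNIV"
    by (subst summable_on_UNIV_nonneg_real_iff) (auto dest: summable_mult[where c = 2])
  then have "(\<lambda>n. 2 * (1 / (real n)\<^sup>2)) summable_on {p. prime p}"
    by (rule summable_on_subset_banach) simp
  from summable_on_add[OF sm this] have a: "a summable_on {p. prime p}"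
    by (simp add: a_def[abs_def] w_def)
  have a0: "a p \<ge> 0" if "p \<in> {p. prime p}" for p
    using fw_le[of p] complex_Re_le_cmod[of "f p * w p"] that by (simp add: a_def prime_gt_0_nat)
  obtain F where F: "finite F" "F \<subseteq> {p. prime p}"
    "\<And>P. finite P \<Longrightarrow> P \<subseteq> {p. prime p} - F \<Longrightarrow> sum a P \<le> 1 / 2"
    by (rule summable_on_small_tail[OF a a0, of "1 / 2"]) auto
  \<comment> \<open>The factor \<open>q\<close> keeps \<open>Q\<close> a period of
    \<open>\<psi>\<close>; the primes in \<open>F\<close> are those whose removal leaves a
    deficiency of at most 1/2.\<close>
  define Q where "Q = q * \<Prod>F"
  have Q: "Q > 0" using q F(1,2) by (auto simp: Q_def prime_gt_0_nat intro!: prod_pos)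
  define v where "v n = (if coprime n Q then w n else 0)" for n
  define g where "g n = f n * v n" for n
  have "\<not> (\<lambda>N. 1 / of_nat N * (\<Sum>n=1..N. g n)) \<longlonglongrightarrow> 0"
  proof (rule mean_not_tendsto_0[OF Q])
    show "g 1 = 1" using f1 dirichlet_character_1[OF chi] by (simp add: g_def v_def w)
    show "norm (g n) \<le> 1" if "n > 0" for n using fw_le[OF that] by (simp add: g_def v_def)
    show "g n = 0" if "\<not> coprime n Q" for n using that by (simp add: g_def v_def)
    show "g (m * n) = g m * g n" if mn: "m > 0" "n > 0" "coprime m n" for m n
    proof -
      have "f (m * n) = f m * f n" using f(1) mn by (simp add: bounded_multiplicative_def)
      moreover have "w (m * n) = w m * w n"
        using mn chi by (simp add: w dirichlet_character_def ln_mult distrib_left flip: cis_mult)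
      ultimately show ?thesis by (simp add: g_def v_def)
    qed
    fix P assume P: "finite P" "\<And>p. p \<in> P \<Longrightarrow> prime p \<and> \<not> p dvd Q"
    have "p dvd Q" if "p \<in> F" for p
      using dvd_prodI[OF F(1) that, of "\<lambda>x. x"] by (simp add: Q_def)
    then have "P \<subseteq> {p. prime p} - F" using P(2) by auto
    from F(3)[OF P(1) this]
    have "sum a P \<le> 1 / 2" .
    moreover have "(\<Sum>p\<in>P. (1 - Re (g p)) / real p + 2 / (real p)\<^sup>2) = sum a P"
    proof (rule sum.cong)
      fix p assume "p \<in> P"
      then have "coprime p Q" using P(2) by (simp add: prime_imp_coprime)
      then show "(1 - Re (g p)) / real p + 2 / (real p)\<^sup>2 = a p" by (simp add: a_def g_def v_def)
    qed simp
    ultimately show "(\<Sum>p\<in>P. (1 - Re (g p)) / real p + 2 / (real p)\<^sup>2) \<le> 1 / 2" by simp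
  qed
  \<comment> \<open>Coprimality to \<open>Q\<close> and \<open>\<psi>\<close> are exactly
    \<open>Q\<close>-periodic. Only the archimedean factor \<open>n^(it)\<close> changes, and
    slowly, because \<open>ln (n + Q) - ln n\<close> tends to 0.\<close>
  moreover have "(\<lambda>n. v (n + Q) - v n) \<longlonglongrightarrow> 0"
  proof (rule Lim_null_comparison)
    show "\<forall>\<^sub>F n in sequentially. norm (v (n + Q) - v n)
        \<le> norm (cis (t * (ln (real n + real Q) - ln (real n))) - 1)"
      using eventually_gt_at_top[of 0]
    proof eventually_elim
      case (elim n)
      have cp: "coprime (n + Q) Q = coprime n Q"
        by (simp add: coprime_iff_gcd_eq_1)
      have per: "\<psi> (n + Q) = \<psi> n"
        using dirichlet_character_periodic[OF chi, of n "\<Prod>F"] by (simp add: Q_def mult.commute)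
      define d where "d = cis (t * (ln (real n + real Q) - ln (real n)))"
      have "cis (t * ln (real n + real Q)) = cis (t * ln (real n)) * d"
        by (simp add: d_def cis_mult algebra_simps)
      then have "w (n + Q) = cnj (\<psi> n * (cis (t * ln n) * d))"
        using elim by (simp only: w per of_nat_add add_pos_nonneg)
      then have "w (n + Q) - w n = cnj (\<psi> n * cis (t * ln n) * (d - 1))"
        using elim by (simp add: w algebra_simps)
      then have "norm (w (n + Q) - w n) = norm (\<psi> n) * norm (d - 1)"
        by (simp only: complex_mod_cnj norm_mult norm_cis mult_1_right)
      then show ?case
        using norm_dirichlet_character_le_1[OF chi, of n]
        by (simp add: v_def cp d_def mult_left_le_one_le)
    qed
    have "(\<lambda>n. ln (real n + real Q) - ln (real n)) \<longlonglongrightarrow> 0"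
      by real_asymp
    then have "(\<lambda>n. norm (cis (t * (ln (real n + real Q) - ln (real n))) - 1)) \<longlonglongrightarrow> norm (cis (t * 0) - 1)"
      unfolding cis_conv_exp by (intro tendsto_intros)
    then show "(\<lambda>n. norm (cis (t * (ln (real n + real Q) - ln (real n))) - 1)) \<longlonglongrightarrow> 0" by simp
  qed
  moreover have "norm (v n) \<le> 1" for n using w_le by (simp add: v_def)
  ultimately show ?thesis using Q by (intro that[of Q v]) (simp_all add: g_def)
qed

text \<open>The class \<open>bounded_multiplicative\<close> contains \<open>0\<close>, which is not pretentious because the sum of
  the reciprocals of the primes diverges. This divergence is obtained from the case \<open>f 1 = 1\<close>,
  applied to the indicator function of \<open>1\<close>.\<close>

lemma pretentious_nonzero_mean:
  assumes f: "f \<in> bounded_multiplicative" "pretentious f"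
  obtains v Q where "Q > 0" "\<And>n. norm (v n) \<le> 1" "(\<lambda>n. v (n + Q) - v n) \<longlonglongrightarrow> 0"
    "\<not> (\<lambda>N. 1 / of_nat N * (\<Sum>n=1..N. f n * v n)) \<longlonglongrightarrow> 0"
proof (cases "f 1 = 1")
  case True
  then show ?thesis using pretentious_nonzero_mean_aux[OF f] that by blast
next
  case False
  have mult: "f (m * n) = f m * f n" if "m > 0" "n > 0" "coprime m n" for m n
    using f(1) that by (simp add: bounded_multiplicative_def)
  have "f 1 = 0" using mult[of 1 1] False by simp
  then have f0: "f n = 0" if "n > 0" for n using mult[of n 1] that by simp
  define e :: "nat \<Rightarrow> complex" where "e n = of_bool (n = 1)" for n
  have "e \<in> bounded_multiplicative" by (auto simp: e_def bounded_multiplicative_def)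
  moreover have "pretentious e"
  proof -
    obtain q \<psi> t where chi: "dirichlet_character q \<psi>" and sm:
      "(\<lambda>p. 1 / real p * (1 - Re (f p * cnj (\<psi> p * of_nat p powr (\<i> * of_real t))))) summable_on {p. prime p}"
      using f(2) unfolding pretentious_def by blast
    have "e p = f p" if "prime p" for p
      using f0[of p] that by (auto simp: e_def prime_gt_0_nat)
    then show ?thesis
      unfolding pretentious_def using chi sm
      by (intro exI[of _ q] exI[of _ \<psi>] exI[of _ t] conjI)
         (assumption, erule summable_on_cong[THEN iffD1, rotated], simp only: mem_Collect_eq)
  qed
  ultimately obtain v Q where v: "\<And>n. norm (v n) \<le> 1"
    "\<not> (\<lambda>N. 1 / of_nat N * (\<Sum>n=1..N. e n * v n)) \<longlonglongrightarrow> 0"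
    by (rule pretentious_nonzero_mean_aux) (auto simp: e_def)
  have "(\<lambda>N. 1 / of_nat N * (\<Sum>n=1..N. e n * v n)) \<longlonglongrightarrow> 0"
  proof (rule Lim_null_comparison)
    have "(\<Sum>n=1..N. e n * v n) = v 1" if "N > 0" for N
      using that by (subst sum.mono_neutral_right[of _ "{1}"]) (auto simp: e_def)
    then show "\<forall>\<^sub>F N in sequentially. norm (1 / of_nat N * (\<Sum>n=1..N. e n * v n)) \<le> 1 / real N"
      using v(1)[of 1] by (intro eventually_sequentiallyI[of 1]) (simp add: norm_mult norm_divide divide_right_mono)
    show "(\<lambda>N. 1 / real N) \<longlonglongrightarrow> 0" by (rule lim_1_over_n)
  qed
  with v(2) show ?thesis by contradiction
qed

section \<open>Correlations along a sequence\<close>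

definition mean :: "nat \<Rightarrow> (nat \<Rightarrow> complex) \<Rightarrow> complex" where
  "mean N F = 1 / of_nat N * (\<Sum>n=1..N. F n)"

text \<open>When the limits exist, the inner product of the \<open>i\<close>-th and
  \<open>j\<close>-th shifts of \<open>F\<close> in the associated system.\<close>

definition corr :: "(nat \<Rightarrow> nat) \<Rightarrow> (nat \<Rightarrow> complex) \<Rightarrow> nat \<Rightarrow> nat \<Rightarrow> complex" where
  "corr N F i j = lim (\<lambda>k. mean (N k) (\<lambda>n. F (n + i) * cnj (F (n + j))))"

lemma mean_diff: "mean N (\<lambda>n. F n - G n) = mean N F - mean N G"
  by (simp add: mean_def sum_subtractf diff_divide_distrib)

lemma mean_sum: "mean N (\<lambda>n. \<Sum>x\<in>A. F x n) = (\<Sum>x\<in>A. mean N (F x))"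
  unfolding mean_def by (subst sum.swap) (simp add: sum_distrib_left sum_divide_distrib)

lemma mean_cmult: "mean N (\<lambda>n. c * F n) = c * mean N F"
  by (simp add: mean_def sum_distrib_left)

lemma cnj_mean: "cnj (mean N F) = mean N (\<lambda>n. cnj (F n))"
  by (simp add: mean_def)

lemma norm_mean_le:
  assumes "\<And>n. n > 0 \<Longrightarrow> norm (F n) \<le> 1"
  shows "norm (mean N F) \<le> 1"
proof -
  have "norm (\<Sum>n=1..N. F n) \<le> (\<Sum>n=1..N. 1)"
    by (intro order_trans[OF norm_sum] sum_mono assms) auto
  then show ?thesis
    by (cases "N = 0") (simp_all add: mean_def norm_mult norm_divide)
qed

lemma mean_tendsto_0:
  assumes N: "filterlim N at_top sequentially" and e: "e \<longlonglongrightarrow> 0"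
  shows "(\<lambda>k. mean (N k) e) \<longlonglongrightarrow> 0"
proof -
  have "(\<lambda>n. mean n e) \<longlonglongrightarrow> 0"
  proof (rule LIMSEQ_I)
    fix r :: real assume r: "r > 0"
    obtain n0 where n0: "\<And>n. n \<ge> n0 \<Longrightarrow> norm (e n) < r / 2"
      using tendstoD[OF e, of "r / 2"] r by (auto simp: eventually_sequentially)
    define C where "C = (\<Sum>n<n0. norm (e n))"
    have "(\<lambda>n. C / real n) \<longlonglongrightarrow> 0" by (rule lim_const_over_n)
    then have "\<forall>\<^sub>F n in sequentially. C / real n < r / 2" using r by (intro order_tendstoD) auto
    then obtain n1 where n1: "\<And>n. n \<ge> n1 \<Longrightarrow> C / real n < r / 2" by (auto simp: eventually_sequentially)
    show "\<exists>no. \<forall>n\<ge>no. norm (mean n e - 0) < r"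
    proof (intro exI[of _ "max 1 n1"] allI impI)
      fix n assume n: "max 1 n1 \<le> n"
      have "norm (\<Sum>k=1..n. e k) \<le> (\<Sum>k=1..n. norm (e k))" by (rule norm_sum)
      also have "\<dots> \<le> (\<Sum>k=1..n. (if k < n0 then norm (e k) else 0) + r / 2)"
        using n0 r by (intro sum_mono) (auto simp: not_less less_imp_le)
      also have "\<dots> = (\<Sum>k=1..n. if k < n0 then norm (e k) else 0) + n * (r / 2)"
        by (simp add: sum.distrib)
      also have "(\<Sum>k=1..n. if k < n0 then norm (e k) else 0) = (\<Sum>k\<in>{1..n} \<inter> {..<n0}. norm (e k))"
        by (simp add: sum.inter_restrict)
      also have "\<dots> \<le> C" unfolding C_def by (rule sum_mono2) auto
      finally have "norm (\<Sum>k=1..n. e k) / n \<le> (C + n * (r / 2)) / n"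
        by (rule divide_right_mono) auto
      also have "\<dots> = C / n + r / 2" using n by (simp add: add_divide_distrib)
      also have "\<dots> < r" using n1[of n] n by linarith
      finally show "norm (mean n e - 0) < r" by (simp add: mean_def norm_mult norm_divide)
    qed
  qed
  then show ?thesis using N by (rule filterlim_compose)
qed

lemma mean_shift:
  assumes N: "filterlim N at_top sequentially" and G: "\<And>n. n > 0 \<Longrightarrow> norm (G n) \<le> 1"
  shows "(\<lambda>k. mean (N k) (\<lambda>n. G (n + m)) - mean (N k) G) \<longlonglongrightarrow> 0"
proof (induction m)
  case (Suc m)
  have "(\<lambda>k. mean (N k) (\<lambda>n. G (n + Suc m)) - mean (N k) (\<lambda>n. G (n + m))) \<longlonglongrightarrow> 0"
  proof (rule Lim_null_comparison)
    have "norm (mean M (\<lambda>n. G (n + Suc m)) - mean M (\<lambda>n. G (n + m))) \<le> 2 / real M" for M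
    proof -
      have "(\<Sum>n=1..M. G (n + Suc m) - G (n + m)) = G (M + Suc m) - G (Suc m)"
        by (induction M) auto
      then have "mean M (\<lambda>n. G (n + Suc m)) - mean M (\<lambda>n. G (n + m)) = (G (M + Suc m) - G (Suc m)) / of_nat M"
        unfolding mean_diff[symmetric] by (simp only: mean_def times_divide_eq_left mult_1)
      moreover have "norm (G (M + Suc m) - G (Suc m)) \<le> 2"
        using norm_triangle_ineq4[of "G (M + Suc m)" "G (Suc m)"] G[of "M + Suc m"] G[of "Suc m"] by simp
      ultimately show ?thesis by (simp add: norm_divide divide_right_mono)
    qed
    then show "\<forall>\<^sub>F k in sequentially. norm (mean (N k) (\<lambda>n. G (n + Suc m)) - mean (N k) (\<lambda>n. G (n + m)))
        \<le> 2 / real (N k)" by simp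
    show "(\<lambda>k. 2 / real (N k)) \<longlonglongrightarrow> 0"
      using filterlim_compose[OF lim_const_over_n[of 2] N] .
  qed
  from tendsto_add[OF this Suc] show ?case by simp
qed simp

lemma Re_mean_norm_squared_nonneg: "0 \<le> Re (mean M (\<lambda>m. of_real ((norm (H m))\<^sup>2)))"
proof -
  have "mean M (\<lambda>m. of_real ((norm (H m))\<^sup>2)) = of_real ((\<Sum>m=1..M. (norm (H m))\<^sup>2) / M)"
    by (simp add: mean_def)
  then show ?thesis by (simp only: Re_complex_of_real) (simp add: sum_nonneg)
qed

lemma norm_mean_mult_le:
  assumes v: "\<And>n. norm (v n) \<le> 1"
  shows "norm (mean M (\<lambda>n. v n * H n)) \<le> sqrt (Re (mean M (\<lambda>n. of_real ((norm (H n))\<^sup>2))))"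
proof (rule real_le_rsqrt)
  have "norm (\<Sum>n=1..M. v n * H n) \<le> (\<Sum>n=1..M. norm (H n))"
    using v by (intro order_trans[OF norm_sum] sum_mono) (simp add: norm_mult mult_left_le_one_le)
  then have "(norm (\<Sum>n=1..M. v n * H n))\<^sup>2 \<le> (\<Sum>n=1..M. norm (H n))\<^sup>2"
    by (rule power_mono) simp
  also have "\<dots> \<le> (\<Sum>n=1..M. (norm (H n))\<^sup>2) * M"
    using sum_squared_le_sum_of_squares[of "\<lambda>n. norm (H n)" "{1..M}"] by simp
  finally have "(norm (\<Sum>n=1..M. v n * H n))\<^sup>2 / (real M)\<^sup>2 \<le> (\<Sum>n=1..M. (norm (H n))\<^sup>2) * M / (real M)\<^sup>2"
    by (rule divide_right_mono) simp
  also have "\<dots> = (\<Sum>n=1..M. (norm (H n))\<^sup>2) / M" by (simp add: power2_eq_square)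
  also have "\<dots> = Re (of_real ((\<Sum>n=1..M. (norm (H n))\<^sup>2) / M))" by (simp only: Re_complex_of_real)
  also have "of_real ((\<Sum>n=1..M. (norm (H n))\<^sup>2) / M) = mean M (\<lambda>n. of_real ((norm (H n))\<^sup>2))"
    by (simp add: mean_def)
  finally show "(norm (mean M (\<lambda>n. v n * H n)))\<^sup>2 \<le> Re (mean M (\<lambda>n. of_real ((norm (H n))\<^sup>2)))"
    by (simp add: mean_def norm_mult norm_divide power_divide)
qed

text \<open>Kept apart from Furstenberg systems because it is used at two levels: for
  \<open>f\<close>, with two-point correlations, and for the products \<open>diff_pair a b\<close>,
  with four-point correlations of \<open>f\<close>.\<close>

locale correlations =
  fixes N :: "nat \<Rightarrow> nat" and F :: "nat \<Rightarrow> complex"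
  assumes N: "filterlim N at_top sequentially"
    and bound: "\<And>n. n > 0 \<Longrightarrow> norm (F n) \<le> 1"
    and conv: "\<And>i j. convergent (\<lambda>k. mean (N k) (\<lambda>n. F (n + i) * cnj (F (n + j))))"
begin

lemma corr: "(\<lambda>k. mean (N k) (\<lambda>n. F (n + i) * cnj (F (n + j)))) \<longlonglongrightarrow> corr N F i j"
  unfolding corr_def using conv by (simp add: convergent_LIMSEQ_iff)

lemma norm_prod_le: "n > 0 \<Longrightarrow> norm (F (n + i) * cnj (F (n + j))) \<le> 1"
  using bound[of "n + i"] bound[of "n + j"] by (simp add: norm_mult mult_le_one)

lemma norm_corr_le: "norm (corr N F i j) \<le> 1"
  by (rule Lim_norm_ubound[OF sequentially_bot corr])
     (auto intro!: always_eventually norm_mean_le norm_prod_le)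

text \<open>With \<open>d i = i\<close> this gives positivity of the kernel; with
  \<open>d i = Q * i\<close> it evaluates the van der Corput average over multiples of
  \<open>Q\<close>.\<close>

lemma mean_norm_squared_tendsto:
  "(\<lambda>k. mean (N k) (\<lambda>m. of_real ((norm (\<Sum>i<n. c i * F (m + d i)))\<^sup>2)))
    \<longlonglongrightarrow> (\<Sum>i<n. \<Sum>j<n. c i * cnj (c j) * corr N F (d i) (d j))"
proof -
  have "mean M (\<lambda>m. of_real ((norm (\<Sum>i<n. c i * F (m + d i)))\<^sup>2))
      = (\<Sum>i<n. \<Sum>j<n. c i * cnj (c j) * mean M (\<lambda>m. F (m + d i) * cnj (F (m + d j))))" for M
    unfolding complex_norm_square mean_cmult[symmetric] mean_sum[symmetric]
    by (intro arg_cong[where f = "mean M"] ext) (simp add: sum_product mult_ac)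
  then show ?thesis by (simp only:) (intro tendsto_sum tendsto_mult tendsto_const corr)
qed

sublocale corr: stationary_kernel "corr N F"
proof
  fix i j n :: nat and c :: "nat \<Rightarrow> complex"
  define G where "G n = F (n + i) * cnj (F (n + j))" for n
  have "(\<lambda>k. mean (N k) (\<lambda>n. G (n + 1)) - mean (N k) G) \<longlonglongrightarrow> 0"
    by (rule mean_shift[OF N]) (simp only: G_def norm_prod_le)
  moreover have "(\<lambda>k. mean (N k) (\<lambda>n. G (n + 1)) - mean (N k) G) \<longlonglongrightarrow> corr N F (Suc i) (Suc j) - corr N F i j"
    using tendsto_diff[OF corr[of "Suc i" "Suc j"] corr[of i j]] by (simp add: G_def[abs_def])
  ultimately show "corr N F (Suc i) (Suc j) = corr N F i j"
    using LIMSEQ_unique by fastforce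
  have "(\<lambda>k. cnj (mean (N k) (\<lambda>n. F (n + i) * cnj (F (n + j))))) \<longlonglongrightarrow> cnj (corr N F i j)"
    by (intro tendsto_cnj corr)
  moreover have "(\<lambda>k. cnj (mean (N k) (\<lambda>n. F (n + i) * cnj (F (n + j))))) \<longlonglongrightarrow> corr N F j i"
    using corr[of j i] by (simp add: cnj_mean mult.commute)
  ultimately show "corr N F j i = cnj (corr N F i j)" using LIMSEQ_unique by blast
  show "0 \<le> Re (\<Sum>i<n. \<Sum>j<n. c i * cnj (c j) * corr N F i j)"
    by (rule tendsto_lowerbound[OF tendsto_Re[OF mean_norm_squared_tendsto[where d = "\<lambda>i. i"]] _ sequentially_bot])
       (intro always_eventually allI Re_mean_norm_squared_nonneg)
qed

text \<open>Since \<open>v\<close> is almost invariant under the shift by \<open>Q\<close>, correlation of \<open>F\<close> with \<open>v\<close>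
  passes to the averages of the shifts of \<open>F\<close> by multiples of \<open>Q\<close>.\<close>

lemma correlation_lower_bound:
  assumes v: "\<And>n. norm (v n) \<le> 1" and per: "(\<lambda>n. v (n + Q) - v n) \<longlonglongrightarrow> 0"
    and \<delta>: "\<delta> \<ge> 0" "\<forall>\<^sub>F k in sequentially. \<delta> \<le> norm (mean (N k) (\<lambda>n. F n * v n))" and J: "J > 0"
  shows "\<delta>\<^sup>2 \<le> Re (\<Sum>i<J. \<Sum>j<J. corr N F (Q * i) (Q * j)) / (real J)\<^sup>2"
proof -
  define c :: complex where "c = 1 / of_nat J"
  \<comment> \<open>In the mean against \<open>v\<close>, \<open>F\<close> may be replaced by the
    average \<open>H\<close> of \<open>J\<close> of its shifts with vanishing error
    \<open>E\<close>. Cauchy-Schwarz then removes \<open>v\<close> and leaves the mean square of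
    \<open>H\<close>, which consists of correlations.\<close>
  define H where "H m = (\<Sum>i<J. c * F (m + Q * i))" for m
  have per': "(\<lambda>n. v (n + Q * i) - v n) \<longlonglongrightarrow> 0" for i
  proof (induction i)
    case (Suc i)
    have "(\<lambda>n. v (n + Q * i + Q) - v (n + Q * i)) \<longlonglongrightarrow> 0"
      using LIMSEQ_ignore_initial_segment[OF per, of "Q * i"] .
    from tendsto_add[OF this Suc] show ?case by (simp add: algebra_simps)
  qed simp
  have shift: "(\<lambda>k. mean (N k) (\<lambda>n. F (n + Q * i) * v n) - mean (N k) (\<lambda>n. F n * v n)) \<longlonglongrightarrow> 0" for i
  proof -
    have "(\<lambda>k. mean (N k) (\<lambda>n. F (n + Q * i) * v (n + Q * i)) - mean (N k) (\<lambda>n. F n * v n)) \<longlonglongrightarrow> 0"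
      by (rule mean_shift[OF N]) (use bound v in \<open>simp add: norm_mult mult_le_one\<close>)
    moreover have "(\<lambda>k. mean (N k) (\<lambda>n. F (n + Q * i) * (v (n + Q * i) - v n))) \<longlonglongrightarrow> 0"
    proof (rule mean_tendsto_0[OF N], rule Lim_null_comparison)
      show "\<forall>\<^sub>F n in sequentially. norm (F (n + Q * i) * (v (n + Q * i) - v n)) \<le> norm (v (n + Q * i) - v n)"
        using eventually_gt_at_top[of 0]
        by eventually_elim (use bound in \<open>simp add: norm_mult mult_left_le_one_le\<close>)
      show "(\<lambda>n. norm (v (n + Q * i) - v n)) \<longlonglongrightarrow> 0" using per'[of i] by (rule tendsto_norm_zero)
    qed
    ultimately show ?thesis
      unfolding right_diff_distrib mean_diff using tendsto_diff by fastforce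
  qed
  define E where "E k = mean (N k) (\<lambda>n. v n * H n) - mean (N k) (\<lambda>n. F n * v n)" for k
  have "mean M (\<lambda>n. v n * H n) = (\<Sum>i<J. c * mean M (\<lambda>n. F (n + Q * i) * v n))" for M
    unfolding H_def mean_cmult[symmetric] mean_sum[symmetric]
    by (simp add: sum_distrib_left mult_ac)
  moreover have "mean M (\<lambda>n. F n * v n) = (\<Sum>i<J. c * mean M (\<lambda>n. F n * v n))" for M
    using J by (simp add: c_def)
  ultimately have "E = (\<lambda>k. \<Sum>i<J. c * (mean (N k) (\<lambda>n. F (n + Q * i) * v n) - mean (N k) (\<lambda>n. F n * v n)))"
    by (intro ext) (simp only: E_def right_diff_distrib sum_subtractf)
  moreover have "(\<lambda>k. \<Sum>i<J. c * (mean (N k) (\<lambda>n. F (n + Q * i) * v n) - mean (N k) (\<lambda>n. F n * v n)))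
      \<longlonglongrightarrow> (\<Sum>i<J. c * 0)"
    by (intro tendsto_sum tendsto_mult tendsto_const shift)
  ultimately have E: "E \<longlonglongrightarrow> 0" by simp
  define R where "R = Re (\<Sum>i<J. \<Sum>j<J. corr N F (Q * i) (Q * j)) / (real J)\<^sup>2"
  have "(\<Sum>i<J. \<Sum>j<J. c * cnj c * corr N F (Q * i) (Q * j))
      = (\<Sum>i<J. \<Sum>j<J. corr N F (Q * i) (Q * j)) / of_real ((real J)\<^sup>2)"
    by (simp add: c_def sum_divide_distrib power2_eq_square)
  then have R: "Re (\<Sum>i<J. \<Sum>j<J. c * cnj c * corr N F (Q * i) (Q * j)) = R"
    by (simp only: R_def Re_divide_of_real)
  have Hlim: "(\<lambda>k. Re (mean (N k) (\<lambda>m. of_real ((norm (H m))\<^sup>2)))) \<longlonglongrightarrow> R"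
    using tendsto_Re[OF mean_norm_squared_tendsto[where n = J and c = "\<lambda>_. c" and d = "\<lambda>i. Q * i"]] unfolding R H_def .
  have "\<delta> \<le> sqrt R + norm (0 :: complex)"
  proof (rule tendsto_lowerbound[OF _ _ sequentially_bot])
    show "(\<lambda>k. sqrt (Re (mean (N k) (\<lambda>m. of_real ((norm (H m))\<^sup>2)))) + norm (E k)) \<longlonglongrightarrow> sqrt R + norm (0 :: complex)"
      by (intro tendsto_intros Hlim E)
    show "\<forall>\<^sub>F k in sequentially. \<delta> \<le> sqrt (Re (mean (N k) (\<lambda>m. of_real ((norm (H m))\<^sup>2)))) + norm (E k)"
      using \<delta>(2)
    proof eventually_elim
      case (elim k)
      have "norm (mean (N k) (\<lambda>n. F n * v n)) = norm (mean (N k) (\<lambda>n. v n * H n) - E k)"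
        by (simp add: E_def)
      also have "\<dots> \<le> norm (mean (N k) (\<lambda>n. v n * H n)) + norm (E k)" by (rule norm_triangle_ineq4)
      also have "\<dots> \<le> sqrt (Re (mean (N k) (\<lambda>m. of_real ((norm (H m))\<^sup>2)))) + norm (E k)"
        using norm_mean_mult_le[OF v] by simp
      finally show ?case using elim by simp
    qed
  qed
  then have "\<delta>\<^sup>2 \<le> (sqrt R)\<^sup>2" using \<delta>(1) by (intro power_mono) auto
  moreover have "R \<ge> 0"
    using Hlim by (rule tendsto_lowerbound) (intro always_eventually allI Re_mean_norm_squared_nonneg, simp)
  ultimately show ?thesis by (simp add: R_def)
qed

text \<open>The van der Corput bound with constant \<open>v\<close> and \<open>Q = 1\<close>: the
  first semi-norm dominates the modulus of the mean. A \<open>\<delta>\<close> strictly below the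
  modulus is an eventual lower bound along the sequence.\<close>

lemma norm_mean_limit_squared_le:
  assumes \<kappa>: "(\<lambda>k. mean (N k) F) \<longlonglongrightarrow> \<kappa>"
  shows "(norm \<kappa>)\<^sup>2 \<le> corr.inf_nrm\<^sup>2"
proof -
  have "\<delta> \<le> corr.inf_nrm" if "\<delta> < norm \<kappa>" for \<delta>
  proof (cases "\<delta> \<ge> 0")
    case True
    have "\<forall>\<^sub>F k in sequentially. \<delta> < norm (mean (N k) F)"
      using order_tendstoD(1)[OF tendsto_norm[OF \<kappa>] that] .
    then have ev: "\<forall>\<^sub>F k in sequentially. \<delta> \<le> norm (mean (N k) (\<lambda>n. F n * 1))"
      by eventually_elim simp
    have "\<delta>\<^sup>2 \<le> corr.inf_nrm\<^sup>2"
    proof (rule corr.inf_nrm_squared_ge)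
      fix J :: nat assume "J > 0"
      from correlation_lower_bound[of "\<lambda>_. 1" 1, OF _ _ True ev this]
      show "\<delta>\<^sup>2 \<le> Re (\<Sum>i<J. \<Sum>j<J. corr N F i j) / (real J)\<^sup>2" by simp
    qed
    then show ?thesis using corr.inf_nrm_nonneg by (rule power2_le_imp_le)
  qed (use corr.inf_nrm_nonneg in simp)
  then have "norm \<kappa> \<le> corr.inf_nrm" by (rule dense_le)
  then show ?thesis by (intro power_mono) auto
qed

end

section \<open>The semi-norm of order two\<close>

text \<open>Each condition is closed and involves finitely many entries.\<close>

lemma stationary_kernel_limit:
  assumes K: "\<And>H. stationary_kernel (K H)" and lim: "\<And>i j. (\<lambda>H. K H i j) \<longlonglongrightarrow> L i j"
  shows "stationary_kernel L"
proof
  fix i j n :: nat and c :: "nat \<Rightarrow> complex"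
  show "L (Suc i) (Suc j) = L i j"
    using lim[of "Suc i" "Suc j"] lim[of i j] stationary_kernel.stationary[OF K]
    by (simp add: LIMSEQ_unique)
  have "(\<lambda>H. K H j i) \<longlonglongrightarrow> cnj (L i j)"
    using tendsto_cnj[OF lim[of i j]] by (simp only: stationary_kernel.hermitian[OF K, symmetric])
  then show "L j i = cnj (L i j)" using lim[of j i] LIMSEQ_unique by blast
  have "(\<lambda>H. Re (\<Sum>i<n. \<Sum>j<n. c i * cnj (c j) * K H i j)) \<longlonglongrightarrow> Re (\<Sum>i<n. \<Sum>j<n. c i * cnj (c j) * L i j)"
    by (intro tendsto_Re tendsto_sum tendsto_mult tendsto_const lim)
  then show "0 \<le> Re (\<Sum>i<n. \<Sum>j<n. c i * cnj (c j) * L i j)"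
    by (rule tendsto_lowerbound)
       (intro always_eventually allI stationary_kernel.pos_semidef[OF K], simp)
qed

lemma stationary_kernel_average:
  assumes K: "\<And>h. stationary_kernel (K h)"
  shows "stationary_kernel (\<lambda>i j. 1 / of_nat H * (\<Sum>h=1..H. K h i j))"
proof
  fix i j n :: nat and c :: "nat \<Rightarrow> complex"
  show "1 / of_nat H * (\<Sum>h=1..H. K h (Suc i) (Suc j)) = 1 / of_nat H * (\<Sum>h=1..H. K h i j)"
    by (simp only: stationary_kernel.stationary[OF K])
  show "1 / of_nat H * (\<Sum>h=1..H. K h j i) = cnj (1 / of_nat H * (\<Sum>h=1..H. K h i j))"
    by (simp add: stationary_kernel.hermitian[OF K, of _ i j])
  have "(\<Sum>i<n. \<Sum>j<n. c i * cnj (c j) * (1 / of_nat H * (\<Sum>h=1..H. K h i j)))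
      = (\<Sum>i<n. \<Sum>j<n. \<Sum>h=1..H. c i * cnj (c j) * K h i j) / of_real H"
    by (simp add: sum_distrib_left sum_divide_distrib)
  also have "(\<Sum>i<n. \<Sum>j<n. \<Sum>h=1..H. c i * cnj (c j) * K h i j)
      = (\<Sum>h=1..H. \<Sum>i<n. \<Sum>j<n. c i * cnj (c j) * K h i j)"
    by (subst (2) sum.swap, subst sum.swap) simp
  finally have "Re (\<Sum>i<n. \<Sum>j<n. c i * cnj (c j) * (1 / of_nat H * (\<Sum>h=1..H. K h i j)))
      = Re (\<Sum>h=1..H. \<Sum>i<n. \<Sum>j<n. c i * cnj (c j) * K h i j) / H"
    by (simp only: Re_divide_of_real)
  also have "\<dots> \<ge> 0"
    unfolding Re_sum[of _ "{1..H}"]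
    by (intro divide_nonneg_nonneg sum_nonneg stationary_kernel.pos_semidef[OF K]) simp
  finally show "0 \<le> Re (\<Sum>i<n. \<Sum>j<n. c i * cnj (c j) * (1 / of_nat H * (\<Sum>h=1..H. K h i j)))" .
qed

locale furstenberg_system =
  fixes N :: "nat \<Rightarrow> nat" and f :: "nat \<Rightarrow> complex"
  assumes furst: "defines_furstenberg_system N f"
    and bound: "\<And>n. n > 0 \<Longrightarrow> norm (f n) \<le> 1"
begin

lemma N_at_top: "filterlim N at_top sequentially"
  using furst by (intro filterlim_subseq) (simp add: defines_furstenberg_system_def)

lemma convergent_mean:
  assumes \<Phi>: "continuous_on disc_seqs \<Phi>"
  shows "convergent (\<lambda>k. mean (N k) (\<lambda>n. \<Phi> (\<lambda>j. extend_zero f (j + int n))))"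
proof -
  obtain \<mu> where "weak_star_converges disc_seqs (\<lambda>k. empirical_measure f (N k)) \<mu>"
    using furst by (auto simp: defines_furstenberg_system_def)
  then have "convergent (\<lambda>k. integral\<^sup>L (empirical_measure f (N k)) \<Phi>)"
    using \<Phi> by (auto simp: weak_star_converges_def convergent_def)
  moreover have "integral\<^sup>L (empirical_measure f M) \<Phi> = mean M (\<lambda>n. \<Phi> (\<lambda>j. extend_zero f (j + int n)))" for M
    unfolding empirical_measure_def
    by (subst integral_distr_uniform_count_measure)
       (use borel_measurable_disc_seqs[OF \<Phi>] shift_extend_zero_in_disc_seqs[OF bound]
         in \<open>auto simp: space_disc_seqs_borel mean_def funpow_seq_shift scaleR_conv_of_real\<close>)
  ultimately show ?thesis by simp
qed

lemma mean_extend_zero: "mean M (\<lambda>n. F (\<lambda>i. extend_zero f (int i + int n))) = mean M (\<lambda>n. F (\<lambda>i. f (n + i)))"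
proof -
  have "extend_zero f (int i + int n) = f (n + i)" if "n \<in> {1..M}" for n i
    using that by (simp add: extend_zero_def nat_int_add add.commute)
  then show ?thesis unfolding mean_def by (intro arg_cong2[where f = "(*)"] sum.cong refl) simp
qed

lemma continuous_on_disc_seqs_coordinate: "continuous_on disc_seqs (\<lambda>x. x j)"
  by (rule continuous_on_subset[OF continuous_on_product_coordinates]) simp

lemma convergent_mean_2: "convergent (\<lambda>k. mean (N k) (\<lambda>n. f (n + a) * cnj (f (n + b))))"
proof -
  have "continuous_on disc_seqs (\<lambda>x :: int \<Rightarrow> complex. x (int a) * cnj (x (int b)))"
    by (intro continuous_intros continuous_on_disc_seqs_coordinate)
  from convergent_mean[OF this] show ?thesis
    using mean_extend_zero[of _ "\<lambda>x. x a * cnj (x b)"] by simp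
qed

lemma convergent_mean_4:
  "convergent (\<lambda>k. mean (N k) (\<lambda>n. f (n + a) * cnj (f (n + b)) * (cnj (f (n + c)) * f (n + d))))"
proof -
  have "continuous_on disc_seqs (\<lambda>x :: int \<Rightarrow> complex. x (int a) * cnj (x (int b)) * (cnj (x (int c)) * x (int d)))"
    by (intro continuous_intros continuous_on_disc_seqs_coordinate)
  from convergent_mean[OF this] show ?thesis
    using mean_extend_zero[of _ "\<lambda>x. x a * cnj (x b) * (cnj (x c) * x d)"] by simp
qed

text \<open>The semi-norm uses \<open>diff_pair h 0\<close> only; two free shifts give a family
  closed under the exchange of lags in \<open>corr_diff_pair_swap\<close>.\<close>

definition diff_pair :: "nat \<Rightarrow> nat \<Rightarrow> nat \<Rightarrow> complex" where
  "diff_pair i j n = f (n + i) * cnj (f (n + j))"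

sublocale f: correlations N f
  by unfold_locales (rule N_at_top, erule bound, rule convergent_mean_2)

sublocale pair: correlations N "diff_pair a b" for a b
proof
  show "norm (diff_pair a b n) \<le> 1" if "n > 0" for n
    unfolding diff_pair_def by (rule f.norm_prod_le[OF that])
  show "convergent (\<lambda>k. mean (N k) (\<lambda>n. diff_pair a b (n + i) * cnj (diff_pair a b (n + j))))" for i j
    using convergent_mean_4[of "i + a" "i + b" "j + a" "j + b"] by (simp add: diff_pair_def add.assoc)
qed (rule N_at_top)

text \<open>This exchange of the two shifts makes the limit over \<open>h\<close> both computable by the mean ergodic
  theorem and a limit of averages of kernels in \<open>(i, j)\<close>.\<close>

lemma corr_diff_pair_swap: "corr N (diff_pair 0 h) i j = corr N (diff_pair i j) 0 h"
  by (simp add: corr_def diff_pair_def mult_ac add_ac)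

text \<open>The squared semi-norm of order one of \<open>diff_pair i j\<close>, regarded as a
  kernel. The limit defining the semi-norm of order two is the ergodic average of its entries at
  \<open>(h, 0)\<close>.\<close>

definition second_corr :: "nat \<Rightarrow> nat \<Rightarrow> complex" where
  "second_corr i j = of_real ((pair.corr.inf_nrm i j)\<^sup>2)"

lemma second_corr:
  "(\<lambda>H. 1 / of_nat H * (\<Sum>h=1..H. corr N (diff_pair 0 h) i j)) \<longlonglongrightarrow> second_corr i j"
  unfolding corr_diff_pair_swap second_corr_def by (rule pair.corr.mean_ergodic)

text \<open>For fixed \<open>h\<close> the correlations of \<open>diff_pair 0 h\<close> form a
  kernel in \<open>(i, j)\<close>; averages over \<open>h\<close> and limits preserve this. The mean
  ergodic theorem thus applies a second time.\<close>

sublocale second: stationary_kernel second_corr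
  by (rule stationary_kernel_limit[OF stationary_kernel_average second_corr])
     (rule pair.corr.stationary_kernel_axioms)

text \<open>The inner \<open>lim\<close> is a correlation of \<open>diff_pair h 0\<close>; the outer
  one is evaluated by the mean ergodic theorem for its kernel.\<close>

lemma u_seminorm_1: "u_seminorm N (Suc 0) (\<lambda>n. f (n + h) * cnj (f n)) = pair.corr.inf_nrm h 0"
proof -
  have "lim (\<lambda>k. 1 / of_nat (N k) * (\<Sum>n=1..N k. f (n + h) * cnj (f n) * cnj (f (n + i + h) * cnj (f (n + i)))))
      = corr N (diff_pair h 0) 0 i" for i
    by (simp add: corr_def mean_def diff_pair_def)
  moreover have "lim (\<lambda>H. 1 / of_nat H * (\<Sum>i=1..H. corr N (diff_pair h 0) 0 i)) = of_real ((pair.corr.inf_nrm h 0)\<^sup>2)"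
    by (rule limI[OF pair.corr.mean_ergodic])
  ultimately show ?thesis
    using pair.corr.inf_nrm_nonneg[of h 0] by (simp only: u_seminorm.simps Re_complex_of_real real_sqrt_unique)
qed

lemma average_second_corr:
  "(\<lambda>H. 1 / real H * (\<Sum>h=1..H. (pair.corr.inf_nrm h 0)\<^sup>2)) \<longlonglongrightarrow> second.inf_nrm\<^sup>2"
proof -
  have "second_corr 0 h = of_real ((pair.corr.inf_nrm h 0)\<^sup>2)" for h
    unfolding second.hermitian[of 0 h] by (simp only: second_corr_def complex_cnj_complex_of_real)
  then have "1 / of_nat H * (\<Sum>h=1..H. second_corr 0 h)
      = of_real (1 / real H * (\<Sum>h=1..H. (pair.corr.inf_nrm h 0)\<^sup>2))" for H
    by simp
  then show ?thesis
    using tendsto_Re[OF second.mean_ergodic] by (simp only: Re_complex_of_real)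
qed

lemma u_seminorm_2: "u_seminorm N 2 f = root 4 (second.inf_nrm\<^sup>2)"
proof -
  have "u_seminorm N (Suc (Suc 0)) f
      = root (2 ^ Suc (Suc 0)) (lim (\<lambda>H. 1 / real H * (\<Sum>h=1..H. (pair.corr.inf_nrm h 0) ^ (2 ^ Suc 0))))"
    unfolding u_seminorm.simps(2) u_seminorm_1 ..
  also have "lim (\<lambda>H. 1 / real H * (\<Sum>h=1..H. (pair.corr.inf_nrm h 0) ^ (2 ^ Suc 0))) = second.inf_nrm\<^sup>2"
    using limI[OF average_second_corr] by simp
  finally have "u_seminorm N (Suc (Suc 0)) f = root (2 ^ Suc (Suc 0)) (second.inf_nrm\<^sup>2)" .
  moreover have "2 ^ Suc (Suc 0) = (4 :: nat)" by simp
  ultimately show ?thesis by (metis numeral_2_eq_2)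
qed

lemma norm_corr_le_inf_nrm: "(norm (corr N f h 0))\<^sup>2 \<le> (pair.corr.inf_nrm h 0)\<^sup>2"
  by (rule pair.norm_mean_limit_squared_le) (use f.corr[of h 0] in \<open>simp add: diff_pair_def[abs_def]\<close>)

text \<open>By stationarity the modulus of an entry depends on the distance of its indices only, and
  each distance occurs at most twice in a row. Hence \<open>\<delta> * J / 2\<close> bounds the sum
  of the \<open>a d\<close> from below, and Cauchy-Schwarz passes to squares.\<close>

lemma norm_corr_sum_lower_bound:
  assumes \<delta>: "\<delta> \<ge> 0" and J: "J > 0"
    and lower: "\<delta> \<le> Re (\<Sum>i<J. \<Sum>j<J. corr N f (Q * i) (Q * j)) / (real J)\<^sup>2"
  shows "J * (\<delta>\<^sup>2 / 4) \<le> (\<Sum>d<J. (norm (corr N f (Q * d) 0))\<^sup>2)"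
proof -
  define a where "a d = norm (corr N f (Q * d) 0)" for d
  have shift: "corr N f (i + m) (j + m) = corr N f i j" for i j m
    by (induction m) (simp_all add: f.corr.stationary)
  have na: "norm (corr N f (Q * i) (Q * j)) = a (if j \<le> i then i - j else j - i)" for i j
  proof (cases "j \<le> i")
    case True
    then show ?thesis using shift[of "Q * (i - j)" "Q * j" 0] by (simp add: a_def flip: distrib_left)
  next
    case False
    then have "corr N f (Q * i) (Q * j) = corr N f 0 (Q * (j - i))"
      using shift[of 0 "Q * i" "Q * (j - i)"] by (simp flip: distrib_left)
    then show ?thesis using False f.corr.hermitian[of 0 "Q * (j - i)"] by (simp add: a_def)
  qed
  have row: "(\<Sum>j<J. norm (corr N f (Q * i) (Q * j))) \<le> 2 * (\<Sum>d<J. a d)" if "i < J" for i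
  proof -
    have a0: "a d \<ge> 0" for d by (simp add: a_def)
    have "(\<Sum>j<J. norm (corr N f (Q * i) (Q * j))) = (\<Sum>j\<in>{..i}. a (i - j)) + (\<Sum>j\<in>{i<..<J}. a (j - i))"
    proof -
      have ivl: "{..<J} = {..i} \<union> {i<..<J}" using that by auto
      have "(\<Sum>j<J. norm (corr N f (Q * i) (Q * j)))
          = (\<Sum>j\<in>{..i}. norm (corr N f (Q * i) (Q * j))) + (\<Sum>j\<in>{i<..<J}. norm (corr N f (Q * i) (Q * j)))"
        unfolding ivl by (rule sum.union_disjoint) auto
      also have "(\<Sum>j\<in>{..i}. norm (corr N f (Q * i) (Q * j))) = (\<Sum>j\<in>{..i}. a (i - j))"
        by (intro sum.cong) (auto simp: na)
      also have "(\<Sum>j\<in>{i<..<J}. norm (corr N f (Q * i) (Q * j))) = (\<Sum>j\<in>{i<..<J}. a (j - i))"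
        by (intro sum.cong) (auto simp: na)
      finally show ?thesis .
    qed
    also have "(\<Sum>j\<in>{..i}. a (i - j)) = (\<Sum>d\<in>{..i}. a d)"
      by (rule sum.reindex_bij_witness[of _ "\<lambda>d. i - d" "\<lambda>d. i - d"]) auto
    also have "\<dots> \<le> (\<Sum>d<J. a d)" using that a0 by (intro sum_mono2) auto
    also have "(\<Sum>j\<in>{i<..<J}. a (j - i)) = (\<Sum>d\<in>{0<..<J - i}. a d)"
      by (rule sum.reindex_bij_witness[of _ "\<lambda>d. d + i" "\<lambda>d. d - i"]) auto
    also have "\<dots> \<le> (\<Sum>d<J. a d)" using a0 by (intro sum_mono2) auto
    finally show ?thesis by simp
  qed
  have "\<delta> * (real J)\<^sup>2 \<le> Re (\<Sum>i<J. \<Sum>j<J. corr N f (Q * i) (Q * j))"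
    using lower J by (simp add: pos_le_divide_eq)
  also have "\<dots> \<le> norm (\<Sum>i<J. \<Sum>j<J. corr N f (Q * i) (Q * j))" by (rule complex_Re_le_cmod)
  also have "\<dots> \<le> (\<Sum>i<J. \<Sum>j<J. norm (corr N f (Q * i) (Q * j)))"
    by (intro order_trans[OF norm_sum] sum_mono) auto
  also have "\<dots> \<le> (\<Sum>i<J. 2 * (\<Sum>d<J. a d))" by (intro sum_mono row) auto
  also have "\<dots> = J * (2 * (\<Sum>d<J. a d))" by simp
  finally have "J * (\<delta> * J) \<le> J * (2 * (\<Sum>d<J. a d))" by (simp add: power2_eq_square mult_ac)
  then have "\<delta> * J / 2 \<le> (\<Sum>d<J. a d)" using J by simp
  then have "(\<delta> * J / 2)\<^sup>2 \<le> (\<Sum>d<J. a d)\<^sup>2" using \<delta> by (intro power_mono) auto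
  also have "\<dots> \<le> (\<Sum>d<J. (a d)\<^sup>2) * J"
    using sum_squared_le_sum_of_squares[of a "{..<J}"] by simp
  finally have "J * (\<delta>\<^sup>2 / 4) * J \<le> (\<Sum>d<J. (a d)\<^sup>2) * J"
    by (simp add: power2_eq_square mult_ac)
  then show ?thesis using J by (simp add: a_def mult_ac)
qed

text \<open>Correlations are controlled at multiples of \<open>Q\<close> only. All terms being
  nonnegative, the others may be dropped, at the price of a factor \<open>1 / Q\<close>; this gives
  the lower bound \<open>\<delta>^4 / (4 * Q)\<close>.\<close>

lemma second_inf_nrm_pos:
  assumes v: "\<And>n. norm (v n) \<le> 1" and Q: "Q > 0" and per: "(\<lambda>n. v (n + Q) - v n) \<longlonglongrightarrow> 0"
    and \<delta>: "\<delta> > 0" "\<And>k. \<delta> \<le> norm (mean (N k) (\<lambda>n. f n * v n))"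
  shows "second.inf_nrm\<^sup>2 > 0"
proof -
  define b where "b h = (norm (corr N f h 0))\<^sup>2" for h
  have b0: "b h \<ge> 0" for h by (simp add: b_def)
  have b1: "b 0 \<le> 1" using f.norm_corr_le[of 0 0] by (simp add: b_def power_le_one)
  \<comment> \<open>The subtracted term accounts for \<open>d = 0\<close>: the lower bound includes
    the lag 0, which contributes at most 1, whereas the averages in the semi-norm start at
    \<open>h = 1\<close>.\<close>
  have avg: "(\<delta>\<^sup>2)\<^sup>2 / (4 * Q) - (1 / Q) / J \<le> 1 / real (Q * J) * (\<Sum>h=1..Q * J. (pair.corr.inf_nrm h 0)\<^sup>2)"
    if J: "J > 0" for J
  proof -
    have "\<delta>\<^sup>2 \<le> Re (\<Sum>i<J. \<Sum>j<J. corr N f (Q * i) (Q * j)) / (real J)\<^sup>2"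
      by (rule f.correlation_lower_bound[OF v per _ _ J]) (use \<delta> in \<open>auto intro: less_imp_le\<close>)
    from norm_corr_sum_lower_bound[OF _ J this]
    have "J * ((\<delta>\<^sup>2)\<^sup>2 / 4) \<le> (\<Sum>d<J. b (Q * d))" by (simp add: b_def)
    also have "\<dots> \<le> (\<Sum>d<Suc J. b (Q * d))" using b0 by simp
    also have "\<dots> = b 0 + (\<Sum>d<J. b (Q * Suc d))" unfolding sum.lessThan_Suc_shift by simp
    also have "(\<Sum>d<J. b (Q * Suc d)) = (\<Sum>h\<in>(\<lambda>d. Q * Suc d) ` {..<J}. b h)"
      using Q by (subst sum.reindex) (auto simp: inj_on_def)
    also have "\<dots> \<le> (\<Sum>h=1..Q * J. b h)"
      using Q b0 by (intro sum_mono2) (auto simp del: mult_Suc_right)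
    also have "\<dots> \<le> (\<Sum>h=1..Q * J. (pair.corr.inf_nrm h 0)\<^sup>2)"
      unfolding b_def by (intro sum_mono norm_corr_le_inf_nrm)
    finally have "J * ((\<delta>\<^sup>2)\<^sup>2 / 4) - 1 \<le> (\<Sum>h=1..Q * J. (pair.corr.inf_nrm h 0)\<^sup>2)" using b1 by simp
    then have "(J * ((\<delta>\<^sup>2)\<^sup>2 / 4) - 1) / real (Q * J) \<le> (\<Sum>h=1..Q * J. (pair.corr.inf_nrm h 0)\<^sup>2) / real (Q * J)"
      by (rule divide_right_mono) simp
    then show ?thesis using J Q by (simp add: diff_divide_distrib)
  qed
  have "(\<delta>\<^sup>2)\<^sup>2 / (4 * Q) - 0 \<le> second.inf_nrm\<^sup>2"
  proof (rule tendsto_le[OF sequentially_bot])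
    \<comment> \<open>The limit over all \<open>H\<close> is known to exist, so it may be computed
      along \<open>H = Q * J\<close>.\<close>
    have "filterlim (\<lambda>J. Q * J) at_top sequentially"
      using Q by (intro filterlim_subseq) (simp add: strict_mono_def)
    from filterlim_compose[OF average_second_corr this]
    show "(\<lambda>J. 1 / real (Q * J) * (\<Sum>h=1..Q * J. (pair.corr.inf_nrm h 0)\<^sup>2)) \<longlonglongrightarrow> second.inf_nrm\<^sup>2" .
    show "(\<lambda>J. (\<delta>\<^sup>2)\<^sup>2 / (4 * Q) - (1 / Q) / real J) \<longlonglongrightarrow> (\<delta>\<^sup>2)\<^sup>2 / (4 * Q) - 0"
      by (intro tendsto_diff tendsto_const lim_const_over_n)
    show "\<forall>\<^sub>F J in sequentially. (\<delta>\<^sup>2)\<^sup>2 / (4 * Q) - (1 / Q) / real J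
        \<le> 1 / real (Q * J) * (\<Sum>h=1..Q * J. (pair.corr.inf_nrm h 0)\<^sup>2)"
      using eventually_gt_at_top[of 0] by eventually_elim (rule avg)
  qed
  moreover have "(\<delta>\<^sup>2)\<^sup>2 / (4 * Q) > 0" using \<delta>(1) Q by simp
  ultimately show ?thesis by linarith
qed

end

theorem proposition3p1:
  fixes f :: "nat \<Rightarrow> complex"
  assumes "f \<in> bounded_multiplicative"
    and "pretentious f"
  shows "\<exists>N. defines_furstenberg_system N f \<and> u_seminorm N 2 f > 0"
proof -
  have bound: "norm (f n) \<le> 1" if "n > 0" for n
    using assms(1) that by (simp add: bounded_multiplicative_def)
  obtain v Q where Q: "Q > 0" and v: "\<And>n. norm (v n) \<le> 1" and per: "(\<lambda>n. v (n + Q) - v n) \<longlonglongrightarrow> 0"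
    and not0: "\<not> (\<lambda>M. mean M (\<lambda>n. f n * v n)) \<longlonglongrightarrow> 0"
    by (rule pretentious_nonzero_mean[OF assms, folded mean_def]) blast
  from not0 obtain \<delta> where \<delta>: "\<delta> > 0" "\<And>n0. \<exists>n\<ge>n0. \<delta> \<le> norm (mean n (\<lambda>n. f n * v n))"
    unfolding LIMSEQ_iff by (auto simp: not_less)
  \<comment> \<open>Selecting the lengths with large mean before extracting the Furstenberg system
    makes the bound \<open>\<delta>\<close> hold for every \<open>k\<close>, so that any further
    subsequence inherits it.\<close>
  define S where "S = {n. n > 0 \<and> \<delta> \<le> norm (mean n (\<lambda>n. f n * v n))}"
  have "\<exists>n>m. n \<in> S" for m
    using \<delta>(2)[of "Suc m"] by (auto simp: S_def Suc_le_eq)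
  then have "infinite S" by (simp add: infinite_nat_iff_unbounded)
  then obtain N0 :: "nat \<Rightarrow> nat" where N0: "strict_mono N0" "\<And>k. N0 k \<in> S"
    using infinite_enumerate by blast
  have "N0 k > 0" for k using N0(2)[of k] by (simp add: S_def)
  then obtain r where r: "defines_furstenberg_system (N0 \<circ> r) f"
    using furstenberg_subsequence[of f N0, OF bound N0(1)] by blast
  interpret furstenberg_system "N0 \<circ> r" f
    by unfold_locales (rule r, erule bound)
  have "second.inf_nrm\<^sup>2 > 0"
    by (rule second_inf_nrm_pos[OF v Q per \<delta>(1)]) (use N0(2) in \<open>simp add: S_def\<close>)
  then have "u_seminorm (N0 \<circ> r) 2 f > 0"
    unfolding u_seminorm_2 by (intro real_root_gt_zero) auto
  with r show ?thesis by blast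
qed

end
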